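(* Let $W\subseteq\mathbf{Gr}_{S_m}^{q}$ be closed and stable under the action of $\mathrm{GL}$. Then: (i) $\mathbf{in}(W)=\mathbf{gin}(W)$. (ii) For every $W'\subseteq W$, both $\mathrm{vs}(\mathbf{in}(W'))$ and $\mathrm{vs}(\mathbf{gin}(W'))$ belong to $W$. (iii) If $W$ is reducible, then its irreducible components are stable under the action of $\mathrm{GL}$. (iv) If $Y_1,\dots,Y_\ell$ are irreducible components of $W$, then every irreducible component of $\bigcap_{i=1}^{\ell}Y_i$ is stable under the action of $\mathrm{GL}$. (v) Let $U\subseteq W$ be open (in $W$) and stable under the action of $\mathrm{GL}$; the irreducible components of $W\setminus U$ and those of the closure $\overline U$ of $U$ are stable under the action of $\mathrm{GL}$.
   Context: $K$ is an infinite field, $S=K[x_0,\dots,x_n]$ with the standard grading, $S_m$ is its degree $m$ component, a term is a monic monomial, $\prec$ is a term order on $S$ with $x_0\prec\dots\prec x_n$, $m,q$ are positive integers. $\mathbf{Gr}_{S_m}^{q}$ is the Grassmannian scheme over $K$ of $q$-dimensional subspaces of $S_m$, embedded in $\mathbb P(\wedge^qS_m)$ by Plücker. Subsets such as $W,W'$ are non-empty sets of (not necessarily closed) points of the scheme. $\mathbf T_{S_m}^{q}$ is the set of $\tau_1\wedge\dots\wedge\tau_q$ with $\tau_i$ terms in $S_m$, $\tau_1\succ\dots\succ\tau_q$, totally ordered by: $\tau_1\wedge\dots\wedge\tau_q\prec\sigma_1\wedge\dots\wedge\sigma_q$ iff for some $j$, $\tau_i=\sigma_i$ for $i<j$ and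 $\tau_j\prec\sigma_j$. For $L=\tau_1\wedge\dots\wedge\tau_q$, $U_L\subseteq\mathbf{Gr}_{S_m}^{q}$ is the open set where the Plücker coordinate $\Delta_L$ is invertible, $\mathrm{vs}(L)=\langle\tau_1,\dots,\tau_q\rangle$, a point of $\mathbf{Gr}_{S_m}^{q}$. $\mathrm{GL}=\mathrm{GL}_K(n+1)$ acts on $S$ by $g(f)=f(\sum_j g_{0j}x_j,\dots,\sum_j g_{nj}x_j)$ and correspondingly, by automorphisms, on $\mathbf{Gr}_{S_m}^{q}$; a set $W$ is stable if $g(W)=W$ for every $g\in\mathrm{GL}$; $\mathcal O(W)=\{g(V):V\in W,\ g\in\mathrm{GL}\}$. $\Delta\mathrm{Supp}(W)=\{L\in\mathbf T_{S_m}^{q}:U_L\cap W\ne\emptyset\}$, $\mathbf{in}(W)=\max_\prec\Delta\mathrm{Supp}(W)$, $\mathbf{gin}(W)=\max_\prec\Delta\mathrm{Supp}(\mathcal O(W))$. *)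

theory Defs
  imports
    "HOL-Library.Poly_Mapping"
    "HOL-Algebra.Ideal"
    "HOL-Analysis.Abstract_Topology"
    "Jordan_Normal_Form.Determinant"
begin

type_synonym ('x, 'k) mpoly = "('x \<Rightarrow>\<^sub>0 nat) \<Rightarrow>\<^sub>0 'k"

text \<open>A term (monic monomial) in \<open>x\<^sub>0, x\<^sub>1, \<dots>\<close> is identified with its exponent vector, so the
  product of terms is addition of exponent vectors and the term \<open>1\<close> is \<open>0\<close>.\<close>

type_synonym xterm = "nat \<Rightarrow>\<^sub>0 nat"

definition Const :: "'k \<Rightarrow> ('x, 'k::comm_ring_1) mpoly" where
  "Const c = Poly_Mapping.single 0 c"

definition Indet :: "'x \<Rightarrow> ('x, 'k::comm_ring_1) mpoly" where
  "Indet x = Poly_Mapping.single (Poly_Mapping.single x 1) 1"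

definition monomial_poly :: "('x \<Rightarrow>\<^sub>0 nat) \<Rightarrow> ('x, 'k::comm_ring_1) mpoly" where
  "monomial_poly t = Poly_Mapping.single t 1"

definition total_deg :: "('x \<Rightarrow>\<^sub>0 nat) \<Rightarrow> nat" where
  "total_deg t = (\<Sum>x\<in>Poly_Mapping.keys t. Poly_Mapping.lookup t x)"

definition hom_component :: "nat \<Rightarrow> ('x, 'k::comm_ring_1) mpoly \<Rightarrow> ('x, 'k) mpoly" where
  "hom_component d F =
     (\<Sum>t\<in>{t \<in> Poly_Mapping.keys F. total_deg t = d}. Poly_Mapping.single t (Poly_Mapping.lookup F t))"

text \<open>The \<open>K\<close>-algebra homomorphism sending each indeterminate \<open>x\<close> to \<open>s x\<close>.\<close>

definition subst :: "('x \<Rightarrow> ('y, 'k) mpoly) \<Rightarrow> ('x, 'k::comm_ring_1) mpoly \<Rightarrow> ('y, 'k) mpoly" where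
  "subst s F =
     (\<Sum>t\<in>Poly_Mapping.keys F. Const (Poly_Mapping.lookup F t) *
        (\<Prod>x\<in>Poly_Mapping.keys t. s x ^ Poly_Mapping.lookup t x))"

text \<open>All terms of \<open>S = K[x\<^sub>0,\<dots>,x\<^sub>n]\<close>, and those of degree \<open>m\<close> (a basis of \<open>S\<^sub>m\<close>).\<close>

definition xterms :: "nat \<Rightarrow> xterm set" where
  "xterms n = {t. Poly_Mapping.keys t \<subseteq> {..n}}"

definition xterms_deg :: "nat \<Rightarrow> nat \<Rightarrow> xterm set" where
  "xterms_deg n m = {t \<in> xterms n. total_deg t = m}"

text \<open>\<open>prec s t\<close> reads \<open>s \<prec> t\<close>.\<close>

definition term_order :: "nat \<Rightarrow> (xterm \<Rightarrow> xterm \<Rightarrow> bool) \<Rightarrow> bool" where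
  "term_order n prec \<longleftrightarrow>
     (\<forall>s\<in>xterms n. \<not> prec s s) \<and>
     (\<forall>s\<in>xterms n. \<forall>t\<in>xterms n. \<forall>u\<in>xterms n. prec s t \<longrightarrow> prec t u \<longrightarrow> prec s u) \<and>
     (\<forall>s\<in>xterms n. \<forall>t\<in>xterms n. s \<noteq> t \<longrightarrow> prec s t \<or> prec t s) \<and>
     (\<forall>s\<in>xterms n. \<forall>t\<in>xterms n. \<forall>u\<in>xterms n. prec s t \<longrightarrow> prec (s + u) (t + u)) \<and>
     (\<forall>t\<in>xterms n. t \<noteq> 0 \<longrightarrow> prec 0 t)"

text \<open>\<open>\<tau>\<^sub>1 \<and> \<dots> \<and> \<tau>\<^sub>q\<close> with \<open>\<tau>\<^sub>1 \<succ> \<dots> \<succ> \<tau>\<^sub>q\<close> is encoded as the list \<open>[\<tau>\<^sub>1, \<dots>, \<tau>\<^sub>q]\<close>.\<close>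

definition wedge_terms ::
  "(xterm \<Rightarrow> xterm \<Rightarrow> bool) \<Rightarrow> nat \<Rightarrow> nat \<Rightarrow> nat \<Rightarrow> xterm list set" where
  "wedge_terms prec n m q =
     {L. length L = q \<and> set L \<subseteq> xterms_deg n m \<and> sorted_wrt (\<lambda>s t. prec t s) L}"

definition wedge_less :: "(xterm \<Rightarrow> xterm \<Rightarrow> bool) \<Rightarrow> xterm list \<Rightarrow> xterm list \<Rightarrow> bool" where
  "wedge_less prec L M \<longleftrightarrow>
     (\<exists>j < min (length L) (length M). (\<forall>i<j. L ! i = M ! i) \<and> prec (L ! j) (M ! j))"

definition wedge_Max :: "(xterm \<Rightarrow> xterm \<Rightarrow> bool) \<Rightarrow> xterm list set \<Rightarrow> xterm list" where
  "wedge_Max prec A = (THE L. L \<in> A \<and> (\<forall>M\<in>A. M \<noteq> L \<longrightarrow> wedge_less prec M L))"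

text \<open>The homogeneous coordinate ring \<open>K[\<Delta>\<^sub>L]\<close> of \<open>\<P>(\<and>\<^sup>q S\<^sub>m)\<close>, with one indeterminate for each
  element \<open>L\<close> of \<^const>\<open>wedge_terms\<close>.\<close>

type_synonym 'k plucker_poly = "(xterm list, 'k) mpoly"

definition plucker_ring ::
  "(xterm \<Rightarrow> xterm \<Rightarrow> bool) \<Rightarrow> nat \<Rightarrow> nat \<Rightarrow> nat \<Rightarrow> 'k::field plucker_poly ring" where
  "plucker_ring prec n m q =
     \<lparr>carrier = {F. \<forall>t\<in>Poly_Mapping.keys F. Poly_Mapping.keys t \<subseteq> wedge_terms prec n m q},
      monoid.mult = (*), one = 1, zero = 0, add = (+)\<rparr>"

text \<open>The \<open>L\<close>-th maximal minor of the generic matrix \<open>(y\<^sub>i\<^sub>\<tau>)\<close> with rows \<open>i = 0, \<dots>, q - 1\<close> and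
  columns indexed by the terms \<open>\<tau>\<close> of degree \<open>m\<close>.\<close>

definition generic_minor :: "xterm list \<Rightarrow> (nat \<times> xterm, 'k::field) mpoly" where
  "generic_minor L = det (mat (length L) (length L) (\<lambda>(i, j). Indet (i, L ! j)))"

text \<open>The homogeneous ideal of the Grassmannian in its Pluecker embedding: the algebraic relations
  between the maximal minors of a generic \<open>q\<close>-rowed matrix.\<close>

definition plucker_ideal ::
  "(xterm \<Rightarrow> xterm \<Rightarrow> bool) \<Rightarrow> nat \<Rightarrow> nat \<Rightarrow> nat \<Rightarrow> 'k::field plucker_poly set" where
  "plucker_ideal prec n m q =
     {F \<in> carrier (plucker_ring prec n m q). subst generic_minor F = 0}"

text \<open>The points, closed or not, of the scheme \<open>Proj (K[\<Delta>\<^sub>L] / plucker_ideal)\<close>: the homogeneous prime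
  ideals of \<open>K[\<Delta>\<^sub>L]\<close> that contain the Pluecker ideal and not all of the \<open>\<Delta>\<^sub>L\<close>.\<close>

definition Gr ::
  "(xterm \<Rightarrow> xterm \<Rightarrow> bool) \<Rightarrow> nat \<Rightarrow> nat \<Rightarrow> nat \<Rightarrow> 'k::field plucker_poly set set" where
  "Gr prec n m q =
     {P. primeideal P (plucker_ring prec n m q) \<and>
         (\<forall>F\<in>P. \<forall>d. hom_component d F \<in> P) \<and>
         plucker_ideal prec n m q \<subseteq> P \<and>
         \<not> Indet ` wedge_terms prec n m q \<subseteq> P}"

text \<open>The Zariski topology: the closed sets are the sets of points containing a given set \<open>J\<close> of
  polynomials.  The elements of \<open>J\<close> need not be homogeneous, since a homogeneous ideal contains \<open>J\<close>
  iff it contains all homogeneous components of the elements of \<open>J\<close>.\<close>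

definition Gr_topology ::
  "(xterm \<Rightarrow> xterm \<Rightarrow> bool) \<Rightarrow> nat \<Rightarrow> nat \<Rightarrow> nat \<Rightarrow> 'k::field plucker_poly set topology" where
  "Gr_topology prec n m q =
     topology (\<lambda>U. \<exists>J \<subseteq> carrier (plucker_ring prec n m q). U = {P \<in> Gr prec n m q. \<not> J \<subseteq> P})"

lemma openin_Gr_topology:
  "openin (Gr_topology prec n m q) U \<longleftrightarrow>
     (\<exists>J \<subseteq> carrier (plucker_ring prec n m q). U = {P \<in> Gr prec n m q. \<not> J \<subseteq> P})"
proof -
  let ?R = "plucker_ring prec n m q :: 'a plucker_poly ring"
  let ?G = "Gr prec n m q :: 'a plucker_poly set set"
  let ?op = "\<lambda>U. \<exists>J \<subseteq> carrier ?R. U = {P \<in> ?G. \<not> J \<subseteq> P}"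
  have "istopology ?op"
    unfolding istopology_def
  proof (intro conjI allI impI)
    fix U V assume "?op U" "?op V"
    then obtain I J where I: "I \<subseteq> carrier ?R" "U = {P \<in> ?G. \<not> I \<subseteq> P}"
      and J: "J \<subseteq> carrier ?R" "V = {P \<in> ?G. \<not> J \<subseteq> P}" by blast
    define H where "H = {a * b | a b. a \<in> I \<and> b \<in> J} \<inter> carrier ?R"
    have "(\<not> I \<subseteq> P \<and> \<not> J \<subseteq> P) \<longleftrightarrow> \<not> H \<subseteq> P" if "P \<in> ?G" for P
    proof -
      interpret primeideal P ?R using that by (simp add: Gr_def)
      have m: "a \<otimes>\<^bsub>?R\<^esub> b = a * b" for a b by (simp add: plucker_ring_def)
      show ?thesis
      proof
        assume "\<not> I \<subseteq> P \<and> \<not> J \<subseteq> P"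
        then obtain a b where ab: "a \<in> I" "a \<notin> P" "b \<in> J" "b \<notin> P" by blast
        then have c: "a \<in> carrier ?R" "b \<in> carrier ?R" using I(1) J(1) by auto
        have "a * b \<in> carrier ?R" using m_closed[OF c] unfolding m .
        moreover have "a * b \<notin> P" using I_prime[OF c] ab unfolding m by auto
        ultimately
        show "\<not> H \<subseteq> P" using ab by (auto simp: H_def)
      next
        assume "\<not> H \<subseteq> P"
        then obtain a b where ab: "a \<in> I" "b \<in> J" "a * b \<notin> P" by (auto simp: H_def)
        then have c: "a \<in> carrier ?R" "b \<in> carrier ?R" using I(1) J(1) by auto
        have "b \<notin> P" using I_l_closed[OF _ c(1), of b] ab(3) unfolding m by auto
        moreover have "a \<notin> P" using I_r_closed[OF _ c(2), of a] ab(3) unfolding m by auto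
        ultimately show "\<not> I \<subseteq> P \<and> \<not> J \<subseteq> P" using ab by auto
      qed
    qed
    then have "U \<inter> V = {P \<in> ?G. \<not> H \<subseteq> P}" unfolding I(2) J(2) by auto
    moreover have "H \<subseteq> carrier ?R" by (simp add: H_def)
    ultimately show "?op (U \<inter> V)" by (intro exI conjI)
  next
    fix \<K> assume "\<forall>K\<in>\<K>. ?op K"
    then obtain J where J: "\<forall>K\<in>\<K>. J K \<subseteq> carrier ?R \<and> K = {P \<in> ?G. \<not> J K \<subseteq> P}"
      using bchoice[of \<K> "\<lambda>K J. J \<subseteq> carrier ?R \<and> K = {P \<in> ?G. \<not> J \<subseteq> P}"] by auto
    have "P \<in> \<Union>\<K> \<longleftrightarrow> P \<in> ?G \<and> \<not> (\<Union>K\<in>\<K>. J K) \<subseteq> P" for P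
    proof -
      have "P \<in> K \<longleftrightarrow> P \<in> ?G \<and> \<not> J K \<subseteq> P" if "K \<in> \<K>" for K
        using J that by (metis (lifting) mem_Collect_eq)
      then show ?thesis unfolding Union_iff UN_subset_iff by meson
    qed
    then have "\<Union>\<K> = {P \<in> ?G. \<not> (\<Union>K\<in>\<K>. J K) \<subseteq> P}" by auto
    moreover have "(\<Union>K\<in>\<K>. J K) \<subseteq> carrier ?R" using J by (meson UN_least)
    ultimately show "?op (\<Union>\<K>)" by (intro exI conjI)
  qed
  then show ?thesis by (simp add: Gr_topology_def topology_inverse')
qed

lemma topspace_Gr_topology: "topspace (Gr_topology prec n m q) = Gr prec n m q"
proof (rule antisym)
  let ?T = "wedge_terms prec n m q"
  have "Indet ` ?T \<subseteq> carrier (plucker_ring prec n m q :: 'a::field plucker_poly ring)"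
    by (auto simp: plucker_ring_def Indet_def)
  moreover have "Gr prec n m q = {P \<in> Gr prec n m q. \<not> Indet ` ?T \<subseteq> (P :: 'a plucker_poly set)}"
    unfolding Gr_def by blast
  ultimately have "openin (Gr_topology prec n m q) (Gr prec n m q :: 'a plucker_poly set set)"
    unfolding openin_Gr_topology by (intro exI conjI)
  then show "(Gr prec n m q :: 'a plucker_poly set set) \<subseteq> topspace (Gr_topology prec n m q)"
    by (rule openin_subset)
  obtain J where "topspace (Gr_topology prec n m q) = {P \<in> Gr prec n m q. \<not> J \<subseteq> (P :: 'a plucker_poly set)}"
    using openin_topspace[of "Gr_topology prec n m q :: 'a plucker_poly set topology"]
    unfolding openin_Gr_topology by blast
  then show "topspace (Gr_topology prec n m q) \<subseteq> (Gr prec n m q :: 'a plucker_poly set set)"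
    by blast
qed

definition U_chart ::
  "(xterm \<Rightarrow> xterm \<Rightarrow> bool) \<Rightarrow> nat \<Rightarrow> nat \<Rightarrow> nat \<Rightarrow> xterm list \<Rightarrow> 'k::field plucker_poly set set" where
  "U_chart prec n m q L = {P \<in> Gr prec n m q. Indet L \<notin> P}"

text \<open>The \<open>L\<close>-th Pluecker coordinate of the subspace of \<open>S\<^sub>m\<close> with basis \<open>fs\<close>.\<close>

definition plucker_coord :: "(nat, 'k::field) mpoly list \<Rightarrow> xterm list \<Rightarrow> 'k" where
  "plucker_coord fs L =
     det (mat (length L) (length L) (\<lambda>(i, j). Poly_Mapping.lookup (fs ! i) (L ! j)))"

text \<open>The \<open>K\<close>-rational point given by the subspace with basis \<open>fs\<close>: the ideal generated by the
  homogeneous polynomials vanishing at its Pluecker coordinates.  Another basis scales these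
  coordinates by a nonzero constant and gives the same ideal.\<close>

definition subspace_point ::
  "(xterm \<Rightarrow> xterm \<Rightarrow> bool) \<Rightarrow> nat \<Rightarrow> nat \<Rightarrow> nat \<Rightarrow> (nat, 'k::field) mpoly list \<Rightarrow>
     'k plucker_poly set" where
  "subspace_point prec n m q fs =
     {F \<in> carrier (plucker_ring prec n m q).
        \<forall>d. subst (\<lambda>L. Const (plucker_coord fs L)) (hom_component d F) = (0 :: 'k plucker_poly)}"

definition vs ::
  "(xterm \<Rightarrow> xterm \<Rightarrow> bool) \<Rightarrow> nat \<Rightarrow> nat \<Rightarrow> nat \<Rightarrow> xterm list \<Rightarrow> 'k::field plucker_poly set" where
  "vs prec n m q L = subspace_point prec n m q (map monomial_poly L)"

definition GL :: "nat \<Rightarrow> 'k::field mat set" where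
  "GL n = {g \<in> carrier_mat (Suc n) (Suc n). invertible_mat g}"

definition act_poly :: "nat \<Rightarrow> 'k::field mat \<Rightarrow> (nat, 'k) mpoly \<Rightarrow> (nat, 'k) mpoly" where
  "act_poly n g f = subst (\<lambda>i. \<Sum>j\<le>n. Const (g $$ (i, j)) * Indet j) f"

text \<open>The pullback of \<open>\<Delta>\<^sub>L\<close> along \<open>V \<mapsto> g(V)\<close>.  The map \<open>\<and>\<^sup>q g\<close> sends
  \<open>v = \<Sum> \<Delta>\<^sub>M(v) M\<close> (sum over all \<open>M = \<tau>\<^sub>1 \<and> \<dots> \<and> \<tau>\<^sub>q\<close>) to
  \<open>\<Sum> \<Delta>\<^sub>M(v) g(\<tau>\<^sub>1) \<and> \<dots> \<and> g(\<tau>\<^sub>q)\<close>, whose \<open>L\<close>-th coordinate is the linear form below.\<close>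

definition act_coord ::
  "(xterm \<Rightarrow> xterm \<Rightarrow> bool) \<Rightarrow> nat \<Rightarrow> nat \<Rightarrow> nat \<Rightarrow> 'k::field mat \<Rightarrow> xterm list \<Rightarrow>
     'k plucker_poly" where
  "act_coord prec n m q g L =
     (\<Sum>M\<in>wedge_terms prec n m q.
        Const (plucker_coord (map (\<lambda>t. act_poly n g (monomial_poly t)) M) L) * Indet M)"

text \<open>On points, an automorphism acts by taking the preimage of the prime ideal under the pullback of
  coordinates: \<open>F\<close> vanishes at \<open>g(P)\<close> iff its pullback along \<open>g\<close> vanishes at \<open>P\<close>.\<close>

definition act_Gr ::
  "(xterm \<Rightarrow> xterm \<Rightarrow> bool) \<Rightarrow> nat \<Rightarrow> nat \<Rightarrow> nat \<Rightarrow> 'k::field mat \<Rightarrow>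
     'k plucker_poly set \<Rightarrow> 'k plucker_poly set" where
  "act_Gr prec n m q g P =
     {F \<in> carrier (plucker_ring prec n m q). subst (act_coord prec n m q g) F \<in> P}"

definition GL_stable ::
  "(xterm \<Rightarrow> xterm \<Rightarrow> bool) \<Rightarrow> nat \<Rightarrow> nat \<Rightarrow> nat \<Rightarrow> 'k::field plucker_poly set set \<Rightarrow> bool" where
  "GL_stable prec n m q W \<longleftrightarrow> (\<forall>g\<in>GL n. act_Gr prec n m q g ` W = W)"

definition GL_orbit ::
  "(xterm \<Rightarrow> xterm \<Rightarrow> bool) \<Rightarrow> nat \<Rightarrow> nat \<Rightarrow> nat \<Rightarrow> 'k::field plucker_poly set set \<Rightarrow>
     'k plucker_poly set set" where
  "GL_orbit prec n m q W = {act_Gr prec n m q g V | g V. V \<in> W \<and> g \<in> GL n}"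

definition DeltaSupp ::
  "(xterm \<Rightarrow> xterm \<Rightarrow> bool) \<Rightarrow> nat \<Rightarrow> nat \<Rightarrow> nat \<Rightarrow> 'k::field plucker_poly set set \<Rightarrow>
     xterm list set" where
  "DeltaSupp prec n m q W = {L \<in> wedge_terms prec n m q. U_chart prec n m q L \<inter> W \<noteq> {}}"

definition in_ext ::
  "(xterm \<Rightarrow> xterm \<Rightarrow> bool) \<Rightarrow> nat \<Rightarrow> nat \<Rightarrow> nat \<Rightarrow> 'k::field plucker_poly set set \<Rightarrow>
     xterm list" where
  "in_ext prec n m q W = wedge_Max prec (DeltaSupp prec n m q W)"

definition gin_ext ::
  "(xterm \<Rightarrow> xterm \<Rightarrow> bool) \<Rightarrow> nat \<Rightarrow> nat \<Rightarrow> nat \<Rightarrow> 'k::field plucker_poly set set \<Rightarrow>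
     xterm list" where
  "gin_ext prec n m q W = wedge_Max prec (DeltaSupp prec n m q (GL_orbit prec n m q W))"

definition irreducible_space :: "'a topology \<Rightarrow> bool" where
  "irreducible_space X \<longleftrightarrow>
     topspace X \<noteq> {} \<and>
     (\<forall>C D. closedin X C \<longrightarrow> closedin X D \<longrightarrow> topspace X = C \<union> D \<longrightarrow>
        C = topspace X \<or> D = topspace X)"

definition irreducible_component :: "'a topology \<Rightarrow> 'a set \<Rightarrow> bool" where
  "irreducible_component X Z \<longleftrightarrow>
     Z \<subseteq> topspace X \<and> irreducible_space (subtopology X Z) \<and>
     (\<forall>Y. Z \<subseteq> Y \<longrightarrow> Y \<subseteq> topspace X \<longrightarrow> irreducible_space (subtopology X Y) \<longrightarrow> Y = Z)"

end

theory Submission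
  imports Defs "HOL-Computational_Algebra.Polynomial"
begin

text \<open>Let \<open>Z\<close> be an irreducible component of a stable set \<open>A\<close>.  The union of the translates of \<open>Z\<close>
  is irreducible: if \<open>F\<close> does not vanish on \<open>g(Z)\<close> and \<open>G\<close> does not vanish on \<open>h(Z)\<close>, then there is
  a single point \<open>P\<close> of \<open>Z\<close> with \<open>F \<noteq> 0\<close> at \<open>g(P)\<close> and \<open>G \<noteq> 0\<close> at \<open>h(P)\<close>, and both remain nonzero at
  \<open>k(P)\<close> for all but finitely many \<open>k\<close> on the line joining \<open>g\<close> and \<open>h\<close>; as \<open>K\<close> is infinite, one of
  these \<open>k\<close> is invertible.  By maximality the union is \<open>Z\<close> itself.  The sets in (iv) and (v) are
  stable, so their components are stable by the same argument.

  For (ii), take a point \<open>P\<close> at which the largest coordinate \<open>\<Delta>\<^sub>L\<close> of the support is invertible.  An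
  equation of the orbit of \<open>P\<close> under the diagonal torus splits into multigraded components.  By the
  Pluecker relations every other \<open>M\<close> in the support of \<open>P\<close> is entry by entry at most \<open>L\<close> after
  reordering, so among the monomials of the multidegree of \<open>\<Delta>\<^sub>L\<^sup>d\<close> only \<open>\<Delta>\<^sub>L\<^sup>d\<close> does not vanish at
  \<open>P\<close>.  Its coefficient is therefore \<open>0\<close>, which says that the equation vanishes at \<open>vs(L)\<close>.\<close>

section \<open>Substitution in polynomials\<close>

lemma Const_0 [simp]: "Const 0 = 0" by (simp add: Const_def)
lemma Const_1 [simp]: "Const 1 = 1" by (simp add: Const_def)
lemma Const_add: "Const (a + b) = Const a + Const b" by (simp add: Const_def single_add)
lemma Const_diff: "Const (a - b) = Const a - Const b" by (simp add: Const_def single_diff)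
lemma Const_uminus: "Const (- a) = - Const a" by (simp add: Const_def single_uminus)
lemma Const_mult: "Const (a * b) = Const a * Const b" by (simp add: Const_def mult_single)
lemma Const_power: "Const (a ^ k) = Const a ^ k" by (induction k) (simp_all add: Const_mult)
lemma Const_sum: "Const (sum f A) = (\<Sum>x\<in>A. Const (f x))"
  by (induction A rule: infinite_finite_induct) (simp_all add: Const_add)

lemma Const_eq_0_iff [simp]: "Const c = 0 \<longleftrightarrow> c = 0"
  by (metis Const_0 Const_def lookup_single_eq lookup_zero)

lemma Const_times_single: "Const c * Poly_Mapping.single t a = Poly_Mapping.single t (c * a)"
  by (simp add: Const_def mult_single)

lemma lookup_Const_times: "Poly_Mapping.lookup (Const c * F) t = c * Poly_Mapping.lookup F t"
  unfolding Const_def mult_map_scale_conv_mult[symmetric] by (simp add: map.rep_eq when_def)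

section \<open>Evaluation of monomials and polynomials\<close>

definition meval :: "('x \<Rightarrow> 'a::comm_monoid_mult) \<Rightarrow> ('x \<Rightarrow>\<^sub>0 nat) \<Rightarrow> 'a" where
  "meval s t = (\<Prod>x\<in>Poly_Mapping.keys t. s x ^ Poly_Mapping.lookup t x)"

lemma meval_superset:
  assumes "finite A" "Poly_Mapping.keys t \<subseteq> A"
  shows "meval s t = (\<Prod>x\<in>A. s x ^ Poly_Mapping.lookup t x)"
  unfolding meval_def using assms by (intro prod.mono_neutral_left) (auto simp: in_keys_iff)

lemma meval_add: "meval s (t + u) = meval s t * meval s u"
proof -
  let ?A = "Poly_Mapping.keys t \<union> Poly_Mapping.keys u"
  have "Poly_Mapping.keys (t + u) \<subseteq> ?A" by (rule Poly_Mapping.keys_add)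
  then show ?thesis
    by (simp add: meval_superset[of ?A] lookup_add power_add prod.distrib)
qed

lemma meval_0 [simp]: "meval s 0 = 1" by (simp add: meval_def)

lemma meval_sum: "meval s (sum f A) = (\<Prod>x\<in>A. meval s (f x))"
  by (induction A rule: infinite_finite_induct) (simp_all add: meval_add)

lemma meval_single: "meval s (Poly_Mapping.single x k) = s x ^ k"
  by (simp add: meval_def)

lemma meval_times: "meval (\<lambda>x. s x * r x) t = meval s t * meval r t"
  by (simp add: meval_def power_mult_distrib prod.distrib)

text \<open>\<open>subst\<close> with the coefficients carried along by \<open>h\<close>, so that
  the target may be any commutative ring. The target \<open>'k poly\<close> occurs in
  \<open>axis_poly\<close> and for a specialised generic matrix.\<close>

definition gsubst ::
  "('k \<Rightarrow> 'a::comm_ring_1) \<Rightarrow> ('x \<Rightarrow> 'a) \<Rightarrow> ('x, 'k::comm_ring_1) mpoly \<Rightarrow> 'a" where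
  "gsubst h s F = (\<Sum>t\<in>Poly_Mapping.keys F. h (Poly_Mapping.lookup F t) * meval s t)"

lemma subst_eq_gsubst: "subst s = gsubst Const s"
  by (simp add: fun_eq_iff subst_def gsubst_def meval_def)

lemma poly_mapping_expand:
  "F = (\<Sum>t\<in>Poly_Mapping.keys F. Poly_Mapping.single t (Poly_Mapping.lookup F t))"
  by (rule poly_mapping_eqI)
    (simp add: lookup_sum lookup_single when_def in_keys_iff sum.delta)

context comm_ring_hom
begin

lemma gsubst_superset:
  assumes "finite A" "Poly_Mapping.keys F \<subseteq> A"
  shows "gsubst hom s F = (\<Sum>t\<in>A. hom (Poly_Mapping.lookup F t) * meval s t)"
  unfolding gsubst_def using assms
  by (intro sum.mono_neutral_left) (auto simp: in_keys_iff)

lemma gsubst_0 [simp]: "gsubst hom s 0 = 0" by (simp add: gsubst_def)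

lemma gsubst_add: "gsubst hom s (F + G) = gsubst hom s F + gsubst hom s G"
proof -
  let ?A = "Poly_Mapping.keys F \<union> Poly_Mapping.keys G"
  have "Poly_Mapping.keys (F + G) \<subseteq> ?A" by (rule Poly_Mapping.keys_add)
  then show ?thesis
    by (simp add: gsubst_superset[of ?A] lookup_add hom_add ring_distribs sum.distrib)
qed

lemma gsubst_sum: "gsubst hom s (sum F A) = (\<Sum>x\<in>A. gsubst hom s (F x))"
  by (induction A rule: infinite_finite_induct) (simp_all add: gsubst_add)

lemma gsubst_single: "gsubst hom s (Poly_Mapping.single t c) = hom c * meval s t"
  by (subst gsubst_superset[of "{t}"]) auto

lemma gsubst_mult: "gsubst hom s (F * G) = gsubst hom s F * gsubst hom s G"
proof -
  have "gsubst hom s (F * G) = gsubst hom s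
      ((\<Sum>t\<in>Poly_Mapping.keys F. Poly_Mapping.single t (Poly_Mapping.lookup F t)) *
       (\<Sum>t\<in>Poly_Mapping.keys G. Poly_Mapping.single t (Poly_Mapping.lookup G t)))"
    by (simp flip: poly_mapping_expand)
  also have "\<dots> = gsubst hom s F * gsubst hom s G"
    by (simp add: sum_product mult_single gsubst_sum gsubst_single gsubst_def[of hom s F]
        gsubst_def[of hom s G] hom_mult meval_add mult_ac)
  finally show ?thesis .
qed

lemma gsubst_Const [simp]: "gsubst hom s (Const c) = hom c"
  by (simp add: Const_def gsubst_single)

lemma gsubst_Indet [simp]: "gsubst hom s (Indet x) = s x"
  by (simp add: Indet_def gsubst_single meval_single)

lemma gsubst_hom: "comm_ring_hom (gsubst hom s)"
  using gsubst_Const[of s 1] by unfold_locales (auto simp: gsubst_add gsubst_mult)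

end

interpretation Const: comm_ring_hom "Const :: 'k::comm_ring_1 \<Rightarrow> ('x, 'k) mpoly"
  by unfold_locales (auto simp: Const_add Const_mult)

lemma hom_meval:
  assumes "comm_ring_hom \<phi>" shows "\<phi> (meval s t) = meval (\<lambda>x. \<phi> (s x)) t"
proof -
  interpret comm_ring_hom \<phi> by fact
  show ?thesis by (simp add: meval_def hom_prod hom_power)
qed

lemma gsubst_subst:
  assumes "comm_ring_hom h"
  shows "gsubst h s (subst r F) = gsubst h (\<lambda>x. gsubst h s (r x)) F"
proof -
  interpret comm_ring_hom h by fact
  show ?thesis
    by (simp add: subst_eq_gsubst gsubst_def[of Const r] gsubst_def[of h "\<lambda>x. gsubst h s (r x)"]
        gsubst_sum gsubst_mult hom_meval[OF gsubst_hom])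
qed

lemma gsubst_cong_keys:
  assumes "\<And>t x. t \<in> Poly_Mapping.keys F \<Longrightarrow> x \<in> Poly_Mapping.keys t \<Longrightarrow> s x = r x"
  shows "gsubst h s F = gsubst h r F"
  unfolding gsubst_def meval_def
  using assms by (intro sum.cong arg_cong2[of _ _ _ _ "(*)"] prod.cong) auto

lemmas subst_superset = Const.gsubst_superset[folded subst_eq_gsubst]
lemmas subst_keys = gsubst_def[of Const, folded subst_eq_gsubst]
lemmas subst_sum = Const.gsubst_sum[folded subst_eq_gsubst]
lemmas subst_mult = Const.gsubst_mult[folded subst_eq_gsubst]
lemmas subst_single = Const.gsubst_single[folded subst_eq_gsubst]
lemmas subst_Const [simp] = Const.gsubst_Const[folded subst_eq_gsubst]
lemmas subst_Indet [simp] = Const.gsubst_Indet[folded subst_eq_gsubst]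
lemmas subst_subst = gsubst_subst[OF Const.comm_ring_hom_axioms, folded subst_eq_gsubst]
lemmas subst_cong_keys = gsubst_cong_keys[of _ _ _ Const, folded subst_eq_gsubst]

interpretation subst: comm_ring_hom "subst s" for s
  unfolding subst_eq_gsubst by (rule Const.gsubst_hom)

lemma meval_Indet: "meval Indet t = (Poly_Mapping.single t 1 :: ('x, 'k::comm_ring_1) mpoly)"
proof -
  have p: "(Indet x :: ('x, 'k) mpoly) ^ k = Poly_Mapping.single (Poly_Mapping.single x k) 1" for x k
    by (induction k) (simp_all add: Indet_def mult_single flip: single_add)
  have q: "(\<Prod>x\<in>A. Poly_Mapping.single (f x) (1::'k)) = Poly_Mapping.single (\<Sum>x\<in>A. f x) 1" for A and f :: "'x \<Rightarrow> 'x \<Rightarrow>\<^sub>0 nat"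
    by (induction A rule: infinite_finite_induct) (simp_all add: mult_single)
  show ?thesis unfolding meval_def p q by (simp flip: poly_mapping_expand)
qed

lemma subst_Indet_id: "subst Indet F = F"
  by (simp add: subst_keys meval_Indet Const_times_single flip: poly_mapping_expand)

section \<open>Polynomial functions and the Cauchy--Binet formula\<close>

text \<open>Dependence on a parameter \<open>t\<close> of K through one fixed polynomial over the
  target ring. Two base maps occur: the identity for scalars, and \<open>Const\<close> for
  polynomials in the \<open>x_i\<close> or in the Pluecker coordinates.\<close>

definition polyfun :: "('k \<Rightarrow> 'a::comm_ring_1) \<Rightarrow> ('k \<Rightarrow> 'a) \<Rightarrow> bool" where
  "polyfun h f \<longleftrightarrow> (\<exists>p. \<forall>t. f t = poly p (h t))"

lemma polyfun_const: "polyfun h (\<lambda>t. c)"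
  unfolding polyfun_def by (rule exI[of _ "[:c:]"]) simp

lemma polyfun_base: "polyfun h h"
  unfolding polyfun_def by (rule exI[of _ "[:0, 1:]"]) simp

lemma polyfun_add: "polyfun h f \<Longrightarrow> polyfun h g \<Longrightarrow> polyfun h (\<lambda>t. f t + g t)"
  unfolding polyfun_def by (metis poly_add)

lemma polyfun_mult: "polyfun h f \<Longrightarrow> polyfun h g \<Longrightarrow> polyfun h (\<lambda>t. f t * g t)"
  unfolding polyfun_def by (metis poly_mult)

lemma polyfun_power: "polyfun h f \<Longrightarrow> polyfun h (\<lambda>t. f t ^ k)"
  unfolding polyfun_def by (metis poly_power)

lemma polyfun_sum: "(\<And>x. x \<in> A \<Longrightarrow> polyfun h (f x)) \<Longrightarrow> polyfun h (\<lambda>t. \<Sum>x\<in>A. f x t)"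
  by (induction A rule: infinite_finite_induct) (auto intro: polyfun_const polyfun_add)

lemma polyfun_prod: "(\<And>x. x \<in> A \<Longrightarrow> polyfun h (f x)) \<Longrightarrow> polyfun h (\<lambda>t. \<Prod>x\<in>A. f x t)"
  by (induction A rule: infinite_finite_induct) (auto intro: polyfun_const polyfun_mult)

lemma permutes_less: "p permutes {0..<d} \<Longrightarrow> i < d \<Longrightarrow> p i < d" for d :: nat
  using permutes_in_image[of p "{0..<d}" i] by simp

lemma det_mat_leibniz:
  fixes A :: "nat \<Rightarrow> nat \<Rightarrow> 'a::comm_ring_1"
  shows "det (mat d d (\<lambda>(i, j). A i j)) =
    (\<Sum>p | p permutes {0..<d}. signof p * (\<Prod>i\<in>{0..<d}. A i (p i)))"
  unfolding det_def by (auto intro!: sum.cong prod.cong simp: permutes_less)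

lemma polyfun_det:
  assumes "\<And>i j. i < d \<Longrightarrow> j < d \<Longrightarrow> polyfun h (\<lambda>t. A t i j)"
  shows "polyfun h (\<lambda>t. det (mat d d (\<lambda>(i, j). A t i j)))"
  unfolding det_mat_leibniz
  by (auto intro!: polyfun_sum polyfun_mult polyfun_const polyfun_prod assms simp: permutes_less)

lemma polyfun_Const:
  fixes c :: "'k::comm_ring_1 \<Rightarrow> 'k"
  assumes "polyfun (\<lambda>t. t) c"
  shows "polyfun Const (\<lambda>t. Const (c t) :: ('x, 'k) mpoly)"
proof -
  obtain p where "c = poly p" using assms by (auto simp: polyfun_def)
  then have "(Const (c t) :: ('x, 'k) mpoly) = (\<Sum>i\<le>degree p. Const (coeff p i) * Const t ^ i)" for t
    by (simp add: poly_altdef Const_sum Const_mult Const_power)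
  then show ?thesis
    by (auto intro!: polyfun_sum polyfun_mult polyfun_power polyfun_base polyfun_const)
qed

lemma polyfun_lookup:
  fixes f :: "'k::comm_ring_1 \<Rightarrow> ('x, 'k) mpoly"
  assumes "polyfun Const f"
  shows "polyfun (\<lambda>t. t) (\<lambda>t. Poly_Mapping.lookup (f t) u)"
proof -
  obtain p where "\<And>t. f t = poly p (Const t)" using assms by (auto simp: polyfun_def)
  then have "f t = (\<Sum>i\<le>degree p. Const (t ^ i) * coeff p i)" for t
    by (simp add: poly_altdef Const_power mult.commute)
  then show ?thesis
    by (auto intro!: polyfun_sum polyfun_mult polyfun_power polyfun_base polyfun_const
        simp: lookup_sum lookup_Const_times)
qed

text \<open>This replaces a Vandermonde determinant. With \<open>p = (X - c) r + p(c)\<close>, the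
  value of \<open>r\<close> at any further \<open>t\<close> is
  \<open>(p(t) - p(c)) / (t - c)\<close>, which is again in the subspace \<open>V\<close>. The
  degree drops, and the coefficients of \<open>p\<close> are combinations of those of
  \<open>r\<close> and of \<open>p(c)\<close>.\<close>

lemma poly_values_in_subspace:
  fixes V :: "('x, 'k::field) mpoly set"
  assumes add: "\<And>a b. a \<in> V \<Longrightarrow> b \<in> V \<Longrightarrow> a + b \<in> V"
    and scale: "\<And>c a. a \<in> V \<Longrightarrow> Const c * a \<in> V"
    and inf: "infinite {t. poly p (Const t) \<in> V}"
  shows "coeff p i \<in> V"
  using inf
proof (induction "degree p" arbitrary: p i rule: less_induct)
  case less
  then obtain c where c: "poly p (Const c) \<in> V"
    using not_finite_existsD by meson
  then have zero: "0 \<in> V" using scale[of _ 0] by fastforce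
  have diff: "a - b \<in> V" if "a \<in> V" "b \<in> V" for a b
    using add[OF that(1) scale[OF that(2), of "-1"]] by (simp add: Const_uminus)
  show ?case
  proof (cases "degree p = 0")
    case True
    then obtain a where "p = [:a:]" using degree_eq_zeroE by blast
    then show ?thesis using c zero by (cases i) auto
  next
    case False
    define r where "r = synthetic_div p (Const c)"
    have pr: "p + smult (Const c) r = pCons (poly p (Const c)) r"
      unfolding r_def by (rule synthetic_div_correct)
    have "poly r (Const t) \<in> V" if "poly p (Const t) \<in> V" "t \<noteq> c" for t
    proof -
      have "poly p (Const t) + Const c * poly r (Const t) = poly p (Const c) + Const t * poly r (Const t)"
        using arg_cong[OF pr, of "\<lambda>p. poly p (Const t)"] by simp
      then have "Const (t - c) * poly r (Const t) = poly p (Const t) - poly p (Const c)"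
        by (simp add: Const_diff algebra_simps)
      then have "Const (t - c) * poly r (Const t) \<in> V" using diff that c by simp
      then have "Const (inverse (t - c)) * (Const (t - c) * poly r (Const t)) \<in> V" by (rule scale)
      then show ?thesis using that(2) by (simp flip: mult.assoc Const_mult)
    qed
    then have "{t. poly p (Const t) \<in> V} - {c} \<subseteq> {t. poly r (Const t) \<in> V}" by auto
    then have "infinite {t. poly r (Const t) \<in> V}"
      using less.prems by (meson finite_Diff2 finite.emptyI finite_insert infinite_super)
    moreover have "degree r < degree p" using False by (simp add: r_def degree_synthetic_div)
    ultimately have r: "coeff r j \<in> V" for j using less.hyps by blast
    have "coeff p i = coeff (pCons (poly p (Const c)) r) i - Const c * coeff r i"
      by (simp flip: pr)
    moreover have "coeff (pCons (poly p (Const c)) r) i \<in> V" using r c by (cases i) auto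
    ultimately show ?thesis using diff scale r by simp
  qed
qed

text \<open>Infinitely many values in \<open>V\<close> would put all coefficients into
  \<open>V\<close>, hence every value. Used with \<open>V\<close> a point of the Grassmannian and
  with \<open>V = {0}\<close>: what is nonzero once on a line of matrices vanishes only finitely
  often there.\<close>

lemma polyfun_nonmember_cofinite:
  fixes V :: "('x, 'k::field) mpoly set"
  assumes add: "\<And>a b. a \<in> V \<Longrightarrow> b \<in> V \<Longrightarrow> a + b \<in> V"
    and scale: "\<And>c a. a \<in> V \<Longrightarrow> Const c * a \<in> V"
    and f: "polyfun Const f" and "f t0 \<notin> V"
  shows "finite {t. f t \<in> V}"
proof (rule ccontr)
  assume inf: "infinite {t. f t \<in> V}"
  obtain p where p: "\<And>t. f t = poly p (Const t)" using f by (auto simp: polyfun_def)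
  have c: "coeff p i \<in> V" for i
    using poly_values_in_subspace[of V p, OF add scale] inf unfolding p by blast
  then have 0: "0 \<in> V" by (metis coeff_eq_0 lessI)
  have "sum g A \<in> V" if "\<And>x. x \<in> A \<Longrightarrow> g x \<in> V" for g and A :: "nat set"
    using that by (induction A rule: infinite_finite_induct) (auto simp: 0 add)
  then have "poly p (Const t0) \<in> V"
    unfolding poly_altdef using c scale by (simp flip: Const_power add: mult.commute)
  then show False using assms(4) p by simp
qed

text \<open>Expand the product multilinearly over all maps from the rows to \<open>T\<close>. A map
  that is not injective contributes a determinant with equal rows; an injective one is an
  enumeration \<open>M\<close> of its image composed with a permutation. \<open>S\<close> may be any
  choice of one enumeration per \<open>q\<close>-subset; below it is the set of wedges.\<close>

lemma cauchy_binet: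
  fixes a :: "nat \<Rightarrow> 'b \<Rightarrow> 'a::comm_ring_1" and b :: "'b \<Rightarrow> nat \<Rightarrow> 'a"
  assumes fin: "finite T"
    and S: "\<And>M. M \<in> S \<Longrightarrow> distinct M \<and> set M \<subseteq> T \<and> length M = q"
    and ex: "\<And>X. X \<subseteq> T \<Longrightarrow> card X = q \<Longrightarrow> \<exists>M\<in>S. set M = X"
    and uniq: "\<And>M N. M \<in> S \<Longrightarrow> N \<in> S \<Longrightarrow> set M = set N \<Longrightarrow> M = N"
  shows "det (mat q q (\<lambda>(i, j). \<Sum>\<tau>\<in>T. a i \<tau> * b \<tau> j)) =
    (\<Sum>M\<in>S. det (mat q q (\<lambda>(i, j). a i (M ! j))) * det (mat q q (\<lambda>(i, j). b (M ! i) j)))"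
proof -
  let ?I = "{0..<q}"
  let ?P = "{p. p permutes ?I}"
  let ?F = "PiE ?I (\<lambda>_. T)"
  let ?G = "{f \<in> ?F. inj_on f ?I}"
  define B where "B f = det (mat q q (\<lambda>(i, j). b (f i) j))" for f :: "nat \<Rightarrow> 'b"
  have finF: "finite ?F" using fin by (intro finite_PiE) auto
  have bij: "bij_betw (\<lambda>(M, p). restrict (\<lambda>i. M ! p i) ?I) (S \<times> ?P) ?G"
  proof (rule bij_betwI')
    fix x y assume "x \<in> S \<times> ?P" "y \<in> S \<times> ?P"
    then obtain M p N r where xy: "x = (M, p)" "y = (N, r)" "M \<in> S" "N \<in> S"
      "p permutes ?I" "r permutes ?I" by auto
    have im: "(\<lambda>i. M ! p i) ` ?I = set M" if "M \<in> S" "p permutes ?I" for M p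
    proof -
      have "(\<lambda>i. M ! p i) ` ?I = (!) M ` p ` ?I" by (simp add: image_image)
      also have "\<dots> = set M"
        using S[OF that(1)] by (simp add: permutes_image[OF that(2)] nth_image)
      finally show ?thesis .
    qed
    show "((case x of (M, p) \<Rightarrow> restrict (\<lambda>i. M ! p i) ?I) =
          (case y of (M, p) \<Rightarrow> restrict (\<lambda>i. M ! p i) ?I)) = (x = y)"
    proof
      assume eq: "(case x of (M, p) \<Rightarrow> restrict (\<lambda>i. M ! p i) ?I) =
          (case y of (M, p) \<Rightarrow> restrict (\<lambda>i. M ! p i) ?I)"
      have e: "M ! p i = N ! r i" if "i \<in> ?I" for i
        using fun_cong[OF eq, of i] that xy by auto
      have "set M = set N" using im xy e by (metis (no_types, lifting) image_cong)
      then have MN: "M = N" using uniq xy by blast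
      have "p i = r i" for i
      proof (cases "i \<in> ?I")
        case True
        then have "p i < q" "r i < q" using xy by (auto simp: permutes_less)
        then show ?thesis using e[OF True] MN S[OF xy(4)] by (metis nth_eq_iff_index_eq)
      next
        case False then show ?thesis using xy by (metis permutes_not_in)
      qed
      then show "x = y" using MN xy by auto
    qed simp
  next
    fix x assume "x \<in> S \<times> ?P"
    then obtain M p where x: "x = (M, p)" "M \<in> S" and p: "p permutes ?I" by auto
    have "M ! p i \<in> T" if "i < q" for i
      using S[OF x(2)] that p by (metis nth_mem permutes_less subset_iff)
    moreover have "inj_on (\<lambda>i. M ! p i) ?I"
      using S[OF x(2)] p by (intro inj_onI) (metis atLeastLessThan_iff nth_eq_iff_index_eq permutes_less permutes_inj injD)
    ultimately show "(case x of (M, p) \<Rightarrow> restrict (\<lambda>i. M ! p i) ?I) \<in> ?G"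
      using x by (auto simp: inj_on_def)
  next
    fix f assume f: "f \<in> ?G"
    then have "f ` ?I \<subseteq> T" "card (f ` ?I) = q" by (auto simp: card_image)
    then obtain M where M: "M \<in> S" "set M = f ` ?I" using ex by blast
    have bM: "bij_betw ((!) M) ?I (set M)"
      using S[OF M(1)] by (intro bij_betw_nth) (auto simp: atLeast0LessThan)
    have bf: "bij_betw f ?I (set M)" using f M by (auto simp: bij_betw_def)
    \<comment> \<open>The permutation is \<open>f\<close> followed by the inverse of the enumeration
      \<open>M\<close>; outside the index range it is the identity, as \<open>permutes\<close>
      requires.\<close>
    define p where "p i = (if i \<in> ?I then inv_into ?I ((!) M) (f i) else i)" for i
    have "bij_betw (inv_into ?I ((!) M) \<circ> f) ?I ?I"
      using bf bij_betw_inv_into[OF bM] by (rule bij_betw_trans)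
    then have "bij_betw p ?I ?I" by (rule bij_betw_cong[THEN iffD1, rotated]) (simp add: p_def)
    then have "p permutes ?I" by (rule bij_imp_permutes) (simp add: p_def)
    moreover have "M ! p i = f i" if "i \<in> ?I" for i
      using that bM bf by (auto simp: p_def bij_betw_def intro!: f_inv_into_f)
    then have "f = restrict (\<lambda>i. M ! p i) ?I"
      using f by (auto simp: fun_eq_iff PiE_def extensional_def)
    ultimately show "\<exists>x\<in>S \<times> ?P. f = (case x of (M, p) \<Rightarrow> restrict (\<lambda>i. M ! p i) ?I)"
      using M(1) by (intro bexI[of _ "(M, p)"]) auto
  qed
  have "det (mat q q (\<lambda>(i, j). \<Sum>\<tau>\<in>T. a i \<tau> * b \<tau> j)) =
      (\<Sum>p\<in>?P. signof p * (\<Sum>f\<in>?F. \<Prod>i\<in>?I. a i (f i) * b (f i) (p i)))"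
    unfolding det_mat_leibniz using fin by (simp add: prod_sum_PiE)
  also have "\<dots> = (\<Sum>f\<in>?F. (\<Prod>i\<in>?I. a i (f i)) * B f)"
    unfolding B_def det_mat_leibniz sum_distrib_left by (subst sum.swap) (simp add: prod.distrib mult_ac)
  also have "\<dots> = (\<Sum>f\<in>?G. (\<Prod>i\<in>?I. a i (f i)) * B f)"
  proof (rule sum.mono_neutral_right[OF finF])
    show "\<forall>f\<in>?F - ?G. (\<Prod>i\<in>?I. a i (f i)) * B f = 0"
    proof
      fix f assume "f \<in> ?F - ?G"
      then obtain i j where "i < q" "j < q" "i \<noteq> j" "f i = f j" by (auto simp: inj_on_def)
      then have "B f = 0" unfolding B_def
        by (intro det_identical_rows[of _ q i j]) auto
      then show "(\<Prod>i\<in>?I. a i (f i)) * B f = 0" by simp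
    qed
  qed auto
  also have "\<dots> = (\<Sum>(M, p)\<in>S \<times> ?P. (\<Prod>i\<in>?I. a i (M ! p i)) * B (\<lambda>i. M ! p i))"
  proof -
    have "B (restrict f ?I) = B f" for f unfolding B_def by (intro arg_cong[of _ _ det]) auto
    then show ?thesis
      by (subst sum.reindex_bij_betw[OF bij, symmetric]) (auto intro!: sum.cong)
  qed
  also have "\<dots> = (\<Sum>M\<in>S. \<Sum>p\<in>?P. (\<Prod>i\<in>?I. a i (M ! p i)) * (signof p * B ((!) M)))"
  proof -
    have "B (\<lambda>i. M ! p i) = signof p * B ((!) M)" if "p \<in> ?P" for M p
    proof -
      have "B (\<lambda>i. M ! p i) = det (mat q q (\<lambda>(i, j). mat q q (\<lambda>(i, j). b (M ! i) j) $$ (p i, j)))"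
        unfolding B_def using that by (intro arg_cong[of _ _ det]) (auto simp: permutes_less)
      then show ?thesis unfolding B_def using that
        by (subst (asm) det_permute_rows) auto
    qed
    then show ?thesis
      unfolding sum.cartesian_product[symmetric]
      by (intro sum.cong refl arg_cong2[of _ _ _ _ "(*)"])
  qed
  also have "\<dots> = (\<Sum>M\<in>S. det (mat q q (\<lambda>(i, j). a i (M ! j))) * B ((!) M))"
    unfolding det_mat_leibniz sum_distrib_right by (simp add: mult_ac)
  finally show ?thesis unfolding B_def .
qed

section \<open>The action on forms\<close>

lemma total_deg_superset:
  assumes "finite A" "Poly_Mapping.keys t \<subseteq> A"
  shows "total_deg t = (\<Sum>x\<in>A. Poly_Mapping.lookup t x)"
  unfolding total_deg_def using assms by (intro sum.mono_neutral_left) (auto simp: in_keys_iff)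

lemma total_deg_add: "total_deg (s + t) = total_deg s + total_deg t"
proof -
  let ?A = "Poly_Mapping.keys s \<union> Poly_Mapping.keys t"
  have "Poly_Mapping.keys (s + t) \<subseteq> ?A" by (rule Poly_Mapping.keys_add)
  then show ?thesis
    by (simp add: total_deg_superset[of ?A] lookup_add sum.distrib)
qed

lemma total_deg_0 [simp]: "total_deg 0 = 0" by (simp add: total_deg_def)

lemma total_deg_sum: "total_deg (sum f A) = (\<Sum>x\<in>A. total_deg (f x))"
  by (induction A rule: infinite_finite_induct) (simp_all add: total_deg_add)

lemma total_deg_sum_list: "total_deg (sum_list L) = sum_list (map total_deg L)"
  by (induction L) (simp_all add: total_deg_add)

lemma xterms_0 [simp]: "0 \<in> xterms n" by (simp add: xterms_def)

lemma xterms_add: "s \<in> xterms n \<Longrightarrow> t \<in> xterms n \<Longrightarrow> s + t \<in> xterms n"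
  unfolding xterms_def using Poly_Mapping.keys_add[of s t] by auto

lemma xterms_sum: "(\<And>x. x \<in> A \<Longrightarrow> f x \<in> xterms n) \<Longrightarrow> sum f A \<in> xterms n"
  by (induction A rule: infinite_finite_induct) (auto intro: xterms_add)

lemma xterms_degD: "t \<in> xterms_deg n d \<Longrightarrow> t \<in> xterms n"
  by (simp add: xterms_deg_def)

lemma xterms_deg_add: "s \<in> xterms_deg n d \<Longrightarrow> t \<in> xterms_deg n e \<Longrightarrow> s + t \<in> xterms_deg n (d + e)"
  by (simp add: xterms_deg_def xterms_add total_deg_add)

lemma finite_xterms_deg: "finite (xterms_deg n d)"
proof -
  have "Poly_Mapping.lookup ` xterms_deg n d \<subseteq>
      {f. (\<forall>x. f x \<in> {..d}) \<and> (\<forall>x. x \<notin> {..n} \<longrightarrow> f x = 0)}" (is "_ \<subseteq> ?B")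
  proof (intro subsetI CollectI conjI allI impI)
    fix f x assume f: "f \<in> Poly_Mapping.lookup ` xterms_deg n d"
    then obtain t where t: "f = Poly_Mapping.lookup t" "Poly_Mapping.keys t \<subseteq> {..n}" "total_deg t = d"
      by (auto simp: xterms_deg_def xterms_def)
    show "f x \<in> {..d}"
    proof (cases "x \<in> Poly_Mapping.keys t")
      case True
      then show ?thesis
        using member_le_sum[of x "Poly_Mapping.keys t" "Poly_Mapping.lookup t"] t by (simp add: total_deg_def)
    qed (simp add: t in_keys_iff)
    show "f x = 0" if "x \<notin> {..n}" using that t by (auto simp: in_keys_iff)
  qed
  moreover have "finite ?B"
    using finite_set_of_finite_funs[of "{..n}" "{..d}" "0::nat"]
    by (rule finite_subset[rotated]) auto
  ultimately have "finite (Poly_Mapping.lookup ` xterms_deg n d)" by (rule finite_subset)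
  then show ?thesis by (rule finite_imageD) (auto intro!: inj_onI poly_mapping_eqI)
qed

definition forms :: "nat \<Rightarrow> nat \<Rightarrow> (nat, 'k::comm_ring_1) mpoly set" where
  "forms n d = {F. Poly_Mapping.keys F \<subseteq> xterms_deg n d}"

lemma forms_mult:
  assumes "F \<in> forms n d" "G \<in> forms n e" shows "F * G \<in> forms n (d + e)"
  using assms Poly_Mapping.keys_mult[of F G] by (fastforce simp: forms_def intro: xterms_deg_add)

lemma forms_1: "1 \<in> forms n 0"
  by (simp add: forms_def xterms_deg_def)

lemma forms_power: "F \<in> forms n d \<Longrightarrow> F ^ k \<in> forms n (d * k)"
  by (induction k) (simp_all add: forms_1 forms_mult)

lemma forms_prod: "(\<And>x. x \<in> A \<Longrightarrow> F x \<in> forms n (d x)) \<Longrightarrow> prod F A \<in> forms n (sum d A)"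
  by (induction A rule: infinite_finite_induct) (auto simp: forms_1 forms_mult)

lemma forms_sum: "(\<And>x. x \<in> A \<Longrightarrow> F x \<in> forms n d) \<Longrightarrow> sum F A \<in> forms n d"
  using keys_sum[of F A] by (fastforce simp: forms_def)

lemma act_poly_monomial:
  "act_poly n g (monomial_poly t) = meval (\<lambda>i. \<Sum>j\<le>n. Const (g $$ (i, j)) * Indet j) t"
  by (simp add: act_poly_def monomial_poly_def subst_single)

lemma act_poly_forms:
  assumes "t \<in> xterms_deg n d" shows "act_poly n g (monomial_poly t) \<in> forms n d"
proof -
  have "Const (c::'a) * Indet j \<in> forms n 1" if "j \<le> n" for c j
    using that
    by (auto simp: Indet_def Const_times_single forms_def xterms_deg_def xterms_def total_deg_def)
  then have lin: "(\<Sum>j\<le>n. Const (g $$ (i, j)) * Indet j) \<in> forms n 1" for i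
    by (intro forms_sum) auto
  have "meval (\<lambda>i. \<Sum>j\<le>n. Const (g $$ (i, j)) * Indet j) t \<in> forms n (\<Sum>x\<in>Poly_Mapping.keys t. 1 * Poly_Mapping.lookup t x)"
    unfolding meval_def by (intro forms_prod forms_power lin)
  then show ?thesis using assms by (simp add: act_poly_monomial xterms_deg_def total_deg_def)
qed

lemma act_poly_expand:
  assumes "F \<in> forms n d"
  shows "act_poly n g F =
    (\<Sum>t\<in>xterms_deg n d. Const (Poly_Mapping.lookup F t) * act_poly n g (monomial_poly t))"
  unfolding act_poly_monomial using assms
  by (simp add: act_poly_def forms_def subst_superset[OF finite_xterms_deg])

text \<open>Substituting \<open>g\<close> into the linear forms of \<open>h\<close> gives the forms
  of the product \<open>h * g\<close>, in this order, so the composite fixes the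
  indeterminates.\<close>

lemma act_poly_inverse:
  assumes g: "g \<in> carrier_mat (Suc n) (Suc n)" and h: "h \<in> carrier_mat (Suc n) (Suc n)"
    and hg: "h * g = 1\<^sub>m (Suc n)" and F: "F \<in> forms n d"
  shows "act_poly n g (act_poly n h F) = F"
proof -
  have "subst (\<lambda>i. \<Sum>j\<le>n. Const (g $$ (i, j)) * Indet j) (\<Sum>j\<le>n. Const (h $$ (i, j)) * Indet j) = Indet i"
    (is "?l = _") if i: "i \<le> n" for i
  proof -
    have "?l = (\<Sum>j\<le>n. \<Sum>k\<le>n. Const (h $$ (i, j) * g $$ (j, k)) * Indet k)"
      by (simp add: subst_sum subst_mult sum_distrib_left Const_mult mult_ac)
    also have "\<dots> = (\<Sum>k\<le>n. Const (\<Sum>j\<le>n. h $$ (i, j) * g $$ (j, k)) * Indet k)"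
      by (subst sum.swap) (simp add: Const_sum sum_distrib_right)
    also have "\<dots> = (\<Sum>k\<le>n. Const (if i = k then 1 else 0) * Indet k)"
    proof (intro sum.cong refl, goal_cases)
      case (1 k)
      have "(\<Sum>j\<le>n. h $$ (i, j) * g $$ (j, k)) = (h * g) $$ (i, k)"
        using 1 i g h by (simp add: scalar_prod_def atLeast0LessThan lessThan_Suc_atMost)
      then show ?case using 1 i by (simp add: hg)
    qed
    also have "\<dots> = (\<Sum>k\<le>n. if i = k then Indet k else 0)" by (intro sum.cong) auto
    finally show ?thesis using i by simp
  qed
  then have "act_poly n g (act_poly n h F) = subst Indet F"
    unfolding act_poly_def subst_subst
    using F by (intro subst_cong_keys) (auto simp: forms_def xterms_deg_def xterms_def)
  then show ?thesis by (simp add: subst_Indet_id)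
qed

section \<open>Terms and wedges of terms\<close>

lemma sorted_wrt_distinct:
  "(\<And>x. x \<in> set xs \<Longrightarrow> \<not> R x x) \<Longrightarrow> sorted_wrt R xs \<Longrightarrow> distinct xs"
  by (induction xs) auto

text \<open>Each head stands in relation \<open>R\<close> to all later entries, so by asymmetry the
  heads agree. Asymmetry is asked for on the entries, since \<open>prec\<close> is an order on
  \<open>xterms n\<close> and not on all exponent vectors.\<close>

lemma sorted_wrt_unique:
  assumes "sorted_wrt R xs" "sorted_wrt R ys" "set xs = set ys"
    and "\<And>x y. x \<in> set xs \<Longrightarrow> y \<in> set xs \<Longrightarrow> R x y \<Longrightarrow> \<not> R y x"
  shows "xs = ys"
  using assms
proof (induction xs arbitrary: ys)
  case (Cons x xs)
  obtain y ys' where ys: "ys = y # ys'" using Cons.prems(3) by (cases ys) auto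
  have x: "\<And>z. z \<in> set xs \<Longrightarrow> R x z" and y: "\<And>z. z \<in> set ys' \<Longrightarrow> R y z"
    using Cons.prems(1,2) ys by auto
  have S: "insert x (set xs) = insert y (set ys')" using Cons.prems(3) ys by simp
  have asym: "\<And>u v. u \<in> insert x (set xs) \<Longrightarrow> v \<in> insert x (set xs) \<Longrightarrow> R u v \<Longrightarrow> \<not> R v u"
    using Cons.prems(4) unfolding list.set by blast
  have xy: "x = y"
  proof (rule ccontr)
    assume "x \<noteq> y"
    then have "x \<in> set ys'" "y \<in> set xs" using S by auto
    then show False using x[of y] y[of x] asym[of x y] by simp
  qed
  moreover have "x \<notin> set xs" using x[of x] asym[of x x] by auto
  moreover have "y \<notin> set ys'" using y[of y] asym[of y y] S by auto
  ultimately have "set xs = set ys'" using S by (metis insert_ident)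
  then have "xs = ys'"
  proof (intro Cons.IH)
    show "sorted_wrt R xs" "sorted_wrt R ys'" using Cons.prems(1,2) ys by simp_all
    show "\<not> R v u" if "u \<in> set xs" "v \<in> set xs" "R u v" for u v
      using asym[of u v] that by blast
  qed
  then show ?case using ys xy by simp
qed simp

locale grassmannian =
  fixes prec :: "xterm \<Rightarrow> xterm \<Rightarrow> bool" and n m q :: nat
  assumes term_order: "term_order n prec"
begin

abbreviation "T \<equiv> xterms_deg n m"
abbreviation "wt \<equiv> wedge_terms prec n m q"

lemma prec_irrefl: "s \<in> xterms n \<Longrightarrow> \<not> prec s s"
  using term_order[unfolded term_order_def, THEN conjunct1] by blast

lemma prec_trans:
  "s \<in> xterms n \<Longrightarrow> t \<in> xterms n \<Longrightarrow> u \<in> xterms n \<Longrightarrow> prec s t \<Longrightarrow> prec t u \<Longrightarrow> prec s u"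
  using term_order[unfolded term_order_def, THEN conjunct2, THEN conjunct1] by blast

lemma prec_total: "s \<in> xterms n \<Longrightarrow> t \<in> xterms n \<Longrightarrow> s \<noteq> t \<Longrightarrow> prec s t \<or> prec t s"
  using term_order[unfolded term_order_def, THEN conjunct2, THEN conjunct2, THEN conjunct1] by blast

lemma prec_add: "s \<in> xterms n \<Longrightarrow> t \<in> xterms n \<Longrightarrow> u \<in> xterms n \<Longrightarrow> prec s t \<Longrightarrow> prec (s + u) (t + u)"
  using term_order[unfolded term_order_def, THEN conjunct2, THEN conjunct2, THEN conjunct2, THEN conjunct1]
  by blast

lemma prec_asym: "s \<in> xterms n \<Longrightarrow> t \<in> xterms n \<Longrightarrow> prec s t \<Longrightarrow> \<not> prec t s"
  using prec_trans[of s t s] prec_irrefl[of s] by blast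

lemma wt_length: "L \<in> wt \<Longrightarrow> length L = q" by (simp add: wedge_terms_def)
lemma wt_set: "L \<in> wt \<Longrightarrow> set L \<subseteq> T" by (simp add: wedge_terms_def)
lemma wt_sorted: "L \<in> wt \<Longrightarrow> sorted_wrt (\<lambda>s t. prec t s) L" by (simp add: wedge_terms_def)
lemma wt_nth: "L \<in> wt \<Longrightarrow> i < q \<Longrightarrow> L ! i \<in> T" using wt_set[of L] wt_length[of L] nth_mem[of i L] by auto
lemma wt_nth_xterms: "L \<in> wt \<Longrightarrow> i < q \<Longrightarrow> L ! i \<in> xterms n" using wt_nth[of L i] xterms_degD[of _ n m] by simp
lemma wt_prec: "L \<in> wt \<Longrightarrow> i < j \<Longrightarrow> j < q \<Longrightarrow> prec (L ! j) (L ! i)"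
  using wt_sorted[of L] wt_length[of L] by (simp add: sorted_wrt_iff_nth_less)

lemma wt_distinct: "L \<in> wt \<Longrightarrow> distinct L"
  using sorted_wrt_distinct[OF _ wt_sorted, of L] wt_set[of L] xterms_degD[of _ n m] prec_irrefl
  by blast

lemma wt_unique:
  assumes "L \<in> wt" "M \<in> wt" "set L = set M"
  shows "L = M"
proof (rule sorted_wrt_unique[OF wt_sorted[OF assms(1)] wt_sorted[OF assms(2)] assms(3)])
  fix s t assume "s \<in> set L" "t \<in> set L" "prec t s"
  then show "\<not> prec s t" using wt_set[OF assms(1)] xterms_degD[of _ n m] prec_asym[of t s] by blast
qed

lemma sorted_list_exists:
  assumes "finite X" "X \<subseteq> xterms n"
  shows "\<exists>L. set L = X \<and> length L = card X \<and> sorted_wrt (\<lambda>s t. prec t s) L"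
  using assms
proof (induction X rule: finite_induct)
  case (insert x X)
  then obtain L where L: "set L = X" "length L = card X" "sorted_wrt (\<lambda>s t. prec t s) L" by auto
  let ?L = "filter (prec x) L @ x # filter (\<lambda>y. prec y x) L"
  have set: "set ?L = insert x X" using L insert prec_total[of x] by auto
  moreover have srt: "sorted_wrt (\<lambda>s t. prec t s) ?L"
    using L insert by (auto simp: sorted_wrt_append sorted_wrt_filter intro: prec_trans[of _ x])
  moreover have "distinct ?L"
  proof -
    have "\<not> prec x x" if "x \<in> set ?L" for x
      using that set insert.prems prec_irrefl by blast
    then show ?thesis using srt by (rule sorted_wrt_distinct)
  qed
  ultimately show ?case using distinct_card[of ?L] by (intro exI[of _ ?L]) simp
qed auto

lemma wt_exists:
  assumes "X \<subseteq> T" "card X = q" shows "\<exists>L\<in>wt. set L = X"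
proof -
  have "X \<subseteq> xterms n" using assms(1) xterms_degD by blast
  then obtain L where "set L = X" "length L = card X" "sorted_wrt (\<lambda>s t. prec t s) L"
    using sorted_list_exists[OF finite_subset[OF assms(1) finite_xterms_deg]] by blast
  then show ?thesis using assms by (auto simp: wedge_terms_def)
qed

lemma finite_wt: "finite wt"
  by (rule finite_subset[OF _ finite_lists_length_eq[OF finite_xterms_deg, of n m q]])
    (auto simp: wedge_terms_def)

lemma wedge_less_iff:
  "L \<in> wt \<Longrightarrow> M \<in> wt \<Longrightarrow>
    wedge_less prec L M \<longleftrightarrow> (\<exists>j<q. (\<forall>i<j. L ! i = M ! i) \<and> prec (L ! j) (M ! j))"
  by (simp add: wedge_less_def wt_length)

lemma wedge_less_trans:
  assumes "L \<in> wt" "M \<in> wt" "N \<in> wt" "wedge_less prec L M" "wedge_less prec M N"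
  shows "wedge_less prec L N"
proof -
  obtain i j where i: "i < q" "\<forall>k<i. L ! k = M ! k" "prec (L ! i) (M ! i)"
    and j: "j < q" "\<forall>k<j. M ! k = N ! k" "prec (M ! j) (N ! j)"
    using assms by (auto simp: wedge_less_iff)
  have "prec (L ! min i j) (N ! min i j)"
  proof (cases i j rule: linorder_cases)
    case equal
    then show ?thesis
      using i j prec_trans[OF assms(1-3)[THEN wt_nth_xterms, of i]] by simp
  qed (use i j in \<open>auto simp: min_def\<close>)
  then show ?thesis using assms i j unfolding wedge_less_iff[OF assms(1,3)]
    by (intro exI[of _ "min i j"]) auto
qed

lemma wedge_less_total:
  assumes "L \<in> wt" "M \<in> wt" "L \<noteq> M"
  shows "wedge_less prec L M \<or> wedge_less prec M L"
proof -
  define j where "j = (LEAST j. j < q \<and> L ! j \<noteq> M ! j)"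
  have "\<exists>j. j < q \<and> L ! j \<noteq> M ! j"
    using nth_equalityI[of L M] assms(3) wt_length[OF assms(1)] wt_length[OF assms(2)] by auto
  then have j: "j < q \<and> L ! j \<noteq> M ! j" unfolding j_def by (rule LeastI_ex)
  then have "L ! i = M ! i" if "i < j" for i
    using not_less_Least[of i "\<lambda>j. j < q \<and> L ! j \<noteq> M ! j"] that by (auto simp: j_def[symmetric])
  moreover have "prec (L ! j) (M ! j) \<or> prec (M ! j) (L ! j)"
    using j assms wt_nth_xterms prec_total by blast
  ultimately show ?thesis using j assms by (auto simp: wedge_less_iff)
qed

lemma wedge_less_irrefl: "L \<in> wt \<Longrightarrow> \<not> wedge_less prec L L"
  using prec_irrefl wt_nth_xterms by (auto simp: wedge_less_iff)

lemma wedge_Max_props: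
  assumes "A \<subseteq> wt" "A \<noteq> {}"
  shows "wedge_Max prec A \<in> A" "\<And>M. M \<in> A \<Longrightarrow> M \<noteq> wedge_Max prec A \<Longrightarrow> wedge_less prec M (wedge_Max prec A)"
proof -
  have "finite A" using assms finite_wt finite_subset by blast
  then have "\<exists>L\<in>A. \<forall>M\<in>A. M \<noteq> L \<longrightarrow> wedge_less prec M L"
    using assms(2,1)
  proof (induction A rule: finite_ne_induct)
    case (insert x A)
    then obtain L where L: "L \<in> A" "\<forall>M\<in>A. M \<noteq> L \<longrightarrow> wedge_less prec M L" by auto
    have "wedge_less prec x L \<or> wedge_less prec L x"
      using wedge_less_total[of x L] L insert by auto
    then show ?case
    proof
      assume "wedge_less prec L x"
      then show ?thesis using L insert.prems wedge_less_trans[of _ L x]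
        by (intro bexI[of _ x]) (auto simp: subset_iff)
    qed (use L in auto)
  qed auto
  then have "\<exists>!L. L \<in> A \<and> (\<forall>M\<in>A. M \<noteq> L \<longrightarrow> wedge_less prec M L)"
  proof (elim bexE, intro ex1I conjI)
    fix L M assume L: "L \<in> A" "\<forall>M\<in>A. M \<noteq> L \<longrightarrow> wedge_less prec M L"
      and M: "M \<in> A \<and> (\<forall>L\<in>A. L \<noteq> M \<longrightarrow> wedge_less prec L M)"
    show "M = L"
    proof (rule ccontr)
      assume "M \<noteq> L"
      then have "wedge_less prec M L" "wedge_less prec L M" using L M by auto
      then show False using wedge_less_trans[of M L M] wedge_less_irrefl[of M] L M assms(1) by auto
    qed
  qed auto
  from theI'[OF this] show "wedge_Max prec A \<in> A"
    "\<And>M. M \<in> A \<Longrightarrow> M \<noteq> wedge_Max prec A \<Longrightarrow> wedge_less prec M (wedge_Max prec A)"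
    unfolding wedge_Max_def by auto
qed

text \<open>For \<open>L = N\<close> the matrix is diagonal because the entries of \<open>N\<close>
  are distinct. Otherwise some \<open>N ! i\<close> is missing from \<open>L\<close> and row
  \<open>i\<close> is zero. The free factors \<open>c\<close> serve for torus weights and for a
  specialised generic matrix.\<close>

lemma det_selection:
  fixes c :: "nat \<Rightarrow> 'a::comm_ring_1"
  assumes "L \<in> wt" "N \<in> wt"
  shows "det (mat q q (\<lambda>(i, j). if L ! j = N ! i then c i else 0)) =
    (if L = N then (\<Prod>i<q. c i) else 0)"
proof (cases "L = N")
  case True
  have D: "mat q q (\<lambda>(i, j). if L ! j = N ! i then c i else 0) =
      mat q q (\<lambda>(i, j). if i = j then c i else 0)" (is "?A = ?D")
    using True wt_length[OF assms(2)] wt_distinct[OF assms(2)]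
    by (intro eq_matI) (auto simp: nth_eq_iff_index_eq)
  have "det ?D = prod_list (diag_mat ?D)" by (rule det_upper_triangular[of _ q]) auto
  then show ?thesis using True unfolding D by (simp add: prod_list_diag_prod atLeast0LessThan)
next
  case False
  then have "set L \<noteq> set N" using assms wt_unique by blast
  moreover have "card (set N) = card (set L)"
    using assms by (simp add: distinct_card wt_distinct wt_length)
  ultimately have "\<not> set N \<subseteq> set L"
    using card_subset_eq[of "set L" "set N"] by auto
  then obtain i where i: "i < q" "N ! i \<notin> set L"
    using wt_length[OF assms(2)] by (auto simp: in_set_conv_nth subset_iff)
  have "(\<Prod>j\<in>{0..<q}. if L ! p j = N ! j then c j else 0) = 0" if "p permutes {0..<q}" for p
  proof (rule prod_zero)
    have "L ! p i \<in> set L" using that i assms by (simp add: permutes_less wt_length)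
    then show "\<exists>j\<in>{0..<q}. (if L ! p j = N ! j then c j else 0) = 0"
      using i by (intro bexI[of _ i]) auto
  qed simp
  then show ?thesis unfolding det_mat_leibniz using False by (simp del: prod_zero_iff)
qed

lemma plucker_coord_scaled_monomials:
  assumes "L \<in> wt" "N \<in> wt"
  shows "plucker_coord (map (\<lambda>t. Const (c t) * monomial_poly t) N) L =
    (if L = N then (\<Prod>i<q. c (N ! i)) else (0 :: 'k::field))"
proof -
  have "plucker_coord (map (\<lambda>t. Const (c t) * monomial_poly t) N) L =
      det (mat q q (\<lambda>(i, j). if L ! j = N ! i then c (N ! i) else 0))"
    unfolding plucker_coord_def wt_length[OF assms(1)] using wt_length[OF assms(2)]
    by (intro arg_cong[of _ _ det] eq_matI)
      (auto simp: monomial_poly_def lookup_Const_times lookup_single when_def)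
  then show ?thesis by (simp add: det_selection[OF assms])
qed

lemma plucker_coord_monomials:
  assumes "L \<in> wt" "N \<in> wt"
  shows "plucker_coord (map monomial_poly N) L = (if L = N then 1 else (0 :: 'k::field))"
  using plucker_coord_scaled_monomials[OF assms, of "\<lambda>_. 1 :: 'k"] by simp

text \<open>Functoriality of the exterior power: compound matrices multiply under composition.
  Cauchy-Binet applies because \<open>wt\<close> lists every \<open>q\<close>-subset of
  \<open>T\<close> exactly once.\<close>

lemma plucker_coord_compose:
  assumes "L \<in> wt" "N \<in> wt"
  shows "(\<Sum>M\<in>wt. plucker_coord (map (\<lambda>t. act_poly n h (monomial_poly t)) N) M *
            plucker_coord (map (\<lambda>t. act_poly n g (monomial_poly t)) M) L) =
         plucker_coord (map (\<lambda>t. act_poly n g (act_poly n h (monomial_poly t))) N) L"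
proof -
  let ?a = "\<lambda>i. Poly_Mapping.lookup (act_poly n h (monomial_poly (N ! i)))"
  let ?b = "\<lambda>t j. Poly_Mapping.lookup (act_poly n g (monomial_poly t)) (L ! j)"
  have "Poly_Mapping.lookup (act_poly n g (act_poly n h (monomial_poly (N ! i)))) (L ! j) =
      (\<Sum>t\<in>T. ?a i t * ?b t j)" if "i < q" for i j
    by (subst act_poly_expand[OF act_poly_forms[OF wt_nth[OF assms(2) that]]])
      (simp add: lookup_sum lookup_Const_times)
  then have "plucker_coord (map (\<lambda>t. act_poly n g (act_poly n h (monomial_poly t))) N) L =
      det (mat q q (\<lambda>(i, j). \<Sum>t\<in>T. ?a i t * ?b t j))"
    using assms by (auto simp: plucker_coord_def wt_length intro!: arg_cong[of _ _ det])
  also have "\<dots> = (\<Sum>M\<in>wt. det (mat q q (\<lambda>(i, j). ?a i (M ! j))) * det (mat q q (\<lambda>(i, j). ?b (M ! i) j)))"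
    using finite_xterms_deg wt_distinct wt_set wt_length wt_exists wt_unique
    by (intro cauchy_binet) auto
  also have "\<dots> = (\<Sum>M\<in>wt. plucker_coord (map (\<lambda>t. act_poly n h (monomial_poly t)) N) M *
            plucker_coord (map (\<lambda>t. act_poly n g (monomial_poly t)) M) L)"
    using assms by (auto simp: plucker_coord_def wt_length intro!: sum.cong arg_cong2[of _ _ _ _ "(*)"] arg_cong[of _ _ det])
  finally show ?thesis by simp
qed

end

section \<open>The action on the Grassmannian\<close>

lemma GL_I:
  fixes g :: "'k::field mat"
  assumes g: "g \<in> carrier_mat (Suc n) (Suc n)" and "det g \<noteq> 0"
  shows "g \<in> GL n"
proof -
  obtain h where "h \<in> carrier_mat (Suc n) (Suc n)" "h * g = 1\<^sub>m (Suc n)" "g * h = 1\<^sub>m (Suc n)"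
    using det_non_zero_imp_unit[OF assms, where b = "()"] g by (auto simp: Units_def ring_mat_def)
  then show ?thesis using g by (auto simp: GL_def invertible_mat_def inverts_mat_def)
qed

lemma GL_carrier: "g \<in> GL n \<Longrightarrow> g \<in> carrier_mat (Suc n) (Suc n)"
  by (simp add: GL_def)

lemma GL_inverse:
  fixes g :: "'k::field mat"
  assumes "g \<in> GL n"
  obtains h where "h \<in> GL n" "h * g = 1\<^sub>m (Suc n)" "g * h = 1\<^sub>m (Suc n)"
proof -
  have g: "g \<in> carrier_mat (Suc n) (Suc n)" using assms by (rule GL_carrier)
  obtain h where h: "g * h = 1\<^sub>m (Suc n)" "h * g = 1\<^sub>m (dim_row h)"
    using assms g by (auto simp: GL_def invertible_mat_def inverts_mat_def)
  \<comment> \<open>\<open>invertible_mat\<close> does not fix the shape of the inverse; both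
    dimensions are read off the two products.\<close>
  have "dim_col h = Suc n" using arg_cong[OF h(1), of dim_col] by simp
  moreover have "dim_row h = Suc n" using arg_cong[OF h(2), of dim_col] g by simp
  ultimately have hc: "h \<in> carrier_mat (Suc n) (Suc n)" by auto
  then have "h \<in> GL n" using g h by (auto simp: GL_def invertible_mat_def inverts_mat_def)
  then show ?thesis using that h hc by auto
qed

lemma GL_det:
  fixes g :: "'k::field mat"
  assumes "g \<in> GL n" shows "det g \<noteq> 0"
proof -
  obtain h where h: "h \<in> GL n" "h * g = 1\<^sub>m (Suc n)" using GL_inverse[OF assms] .
  have "det h * det g = 1"
    using det_mult[OF GL_carrier[OF h(1)] GL_carrier[OF assms]] h by simp
  then show ?thesis by auto
qed

lemma GL_one: "(1\<^sub>m (Suc n) :: 'k::field mat) \<in> GL n"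
  by (rule GL_I) auto

section \<open>Pullback of Pluecker coordinates and its effect on points\<close>

context grassmannian begin

abbreviation "Top \<equiv> Gr_topology prec n m q"
abbreviation "X \<equiv> Gr prec n m q"
abbreviation "C \<equiv> carrier (plucker_ring prec n m q)"
abbreviation "coact g \<equiv> subst (act_coord prec n m q g)"
abbreviation "act \<equiv> act_Gr prec n m q"

lemma C_iff: "F \<in> C \<longleftrightarrow> (\<forall>t\<in>Poly_Mapping.keys F. Poly_Mapping.keys t \<subseteq> wt)"
  by (simp add: plucker_ring_def)

lemma C_add: "F \<in> C \<Longrightarrow> G \<in> C \<Longrightarrow> F + G \<in> C"
  unfolding C_iff using Poly_Mapping.keys_add[of F G] by blast

lemma C_mult:
  assumes "F \<in> C" "G \<in> C" shows "F * G \<in> C"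
  unfolding C_iff
proof
  fix t assume "t \<in> Poly_Mapping.keys (F * G)"
  then obtain a b where "a \<in> Poly_Mapping.keys F" "b \<in> Poly_Mapping.keys G" "t = a + b"
    using Poly_Mapping.keys_mult[of F G] by blast
  then show "Poly_Mapping.keys t \<subseteq> wt"
    using assms Poly_Mapping.keys_add[of a b] unfolding C_iff by blast
qed

lemma C_Const: "Const c \<in> C" by (simp add: C_iff Const_def)
lemma C_0: "0 \<in> C" using C_Const[of 0] by simp
lemma C_1: "1 \<in> C" using C_Const[of 1] by simp
lemma C_Indet: "L \<in> wt \<Longrightarrow> Indet L \<in> C" by (simp add: C_iff Indet_def)

lemma C_sum: "(\<And>x. x \<in> A \<Longrightarrow> F x \<in> C) \<Longrightarrow> sum F A \<in> C"
  by (induction A rule: infinite_finite_induct) (auto intro: C_0 C_add)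

lemma C_prod: "(\<And>x. x \<in> A \<Longrightarrow> F x \<in> C) \<Longrightarrow> prod F A \<in> C"
  by (induction A rule: infinite_finite_induct) (auto intro: C_1 C_mult)

lemma C_power: "F \<in> C \<Longrightarrow> F ^ k \<in> C"
  by (induction k) (auto intro: C_1 C_mult)

lemma C_subst: "(\<And>x. s x \<in> C) \<Longrightarrow> subst s F \<in> C"
  unfolding subst_def by (intro C_sum C_mult C_Const C_prod C_power)

lemma C_coact: "coact g F \<in> C"
  by (rule C_subst) (auto simp: act_coord_def intro!: C_sum C_mult C_Const C_Indet)

lemma C_subst_cong:
  "F \<in> C \<Longrightarrow> (\<And>L. L \<in> wt \<Longrightarrow> s L = r L) \<Longrightarrow> subst s F = subst r F"
  by (rule subst_cong_keys) (auto simp: C_iff)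

text \<open>Translates primality from the record operations of \<open>plucker_ring\<close> to the
  operations on polynomials.\<close>

lemma Gr_props:
  assumes "P \<in> X"
  shows "P \<subseteq> C"
    and "\<And>F G. F \<in> P \<Longrightarrow> G \<in> P \<Longrightarrow> F + G \<in> P"
    and "\<And>F G. F \<in> C \<Longrightarrow> G \<in> P \<Longrightarrow> F * G \<in> P"
    and "\<And>F G. F \<in> C \<Longrightarrow> G \<in> C \<Longrightarrow> F * G \<in> P \<Longrightarrow> F \<in> P \<or> G \<in> P"
    and "1 \<notin> P"
    and "plucker_ideal prec n m q \<subseteq> P"
proof -
  interpret primeideal P "plucker_ring prec n m q" using assms by (simp add: Gr_def)
  have ops: "F \<otimes>\<^bsub>plucker_ring prec n m q\<^esub> G = F * G" "F \<oplus>\<^bsub>plucker_ring prec n m q\<^esub> G = F + G"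
    "\<one>\<^bsub>plucker_ring prec n m q\<^esub> = (1 :: 'a plucker_poly)" for F G :: "'a plucker_poly"
    by (simp_all add: plucker_ring_def)
  show "P \<subseteq> C" using a_subset .
  show "\<And>F G. F \<in> P \<Longrightarrow> G \<in> P \<Longrightarrow> F + G \<in> P" using additive_subgroup.a_closed[OF is_additive_subgroup] unfolding ops .
  show "\<And>F G. F \<in> C \<Longrightarrow> G \<in> P \<Longrightarrow> F * G \<in> P" using I_l_closed unfolding ops by blast
  show "\<And>F G. F \<in> C \<Longrightarrow> G \<in> C \<Longrightarrow> F * G \<in> P \<Longrightarrow> F \<in> P \<or> G \<in> P"
    using I_prime unfolding ops by blast
  show "1 \<notin> P" using one_imp_carrier I_notcarr unfolding ops by blast
  show "plucker_ideal prec n m q \<subseteq> P" using assms by (simp add: Gr_def)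
qed

lemma Gr_scale: "P \<in> X \<Longrightarrow> F \<in> P \<Longrightarrow> Const c * F \<in> P"
  using Gr_props(3) C_Const by blast

lemma Gr_0: "P \<in> X \<Longrightarrow> 0 \<in> P"
  using additive_subgroup.zero_closed[of P "plucker_ring prec n m q"]
  by (simp add: Gr_def primeideal_def ideal_def) (simp add: plucker_ring_def)

lemma Gr_uminus: "P \<in> X \<Longrightarrow> F \<in> P \<Longrightarrow> - F \<in> P"
  using Gr_scale[of P F "-1"] by (simp add: Const_uminus)

lemma Gr_sum: "P \<in> X \<Longrightarrow> (\<And>x. x \<in> A \<Longrightarrow> F x \<in> P) \<Longrightarrow> sum F A \<in> P"
  by (induction A rule: infinite_finite_induct) (auto intro: Gr_0 Gr_props(2))

lemma Gr_power:
  assumes "P \<in> X" "F \<in> C" "F \<notin> P" shows "F ^ k \<notin> P"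
  using Gr_props(4)[OF assms(1,2) C_power[OF assms(2)]] Gr_props(5)[OF assms(1)] assms(3)
  by (induction k) auto

text \<open>On a coordinate the composite is the linear form belonging to
  \<open>act_poly n g\<close> after \<open>act_poly n h\<close>. This map fixes the terms of degree
  \<open>m\<close>, so the coefficients of the form are Kronecker deltas.\<close>

lemma coact_coact:
  assumes g: "g \<in> carrier_mat (Suc n) (Suc n)" and h: "h \<in> carrier_mat (Suc n) (Suc n)"
    and hg: "h * g = 1\<^sub>m (Suc n)" and F: "F \<in> C"
  shows "coact h (coact g F) = F"
proof -
  have "coact h (act_coord prec n m q g L) = Indet L" if L: "L \<in> wt" for L
  proof -
    let ?c = "\<lambda>g N M. plucker_coord (map (\<lambda>t. act_poly n g (monomial_poly t)) N) M"
    have "coact h (act_coord prec n m q g L) =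
        (\<Sum>M\<in>wt. \<Sum>N\<in>wt. Const (?c h N M * ?c g M L) * Indet N)"
      unfolding act_coord_def[of _ _ _ _ g] subst_sum subst_mult subst_Const subst_Indet
      by (simp add: act_coord_def sum_distrib_left Const_mult mult_ac)
    also have "\<dots> = (\<Sum>N\<in>wt. Const (\<Sum>M\<in>wt. ?c h N M * ?c g M L) * Indet N)"
      by (subst sum.swap) (simp add: Const_sum sum_distrib_right)
    also have "\<dots> = (\<Sum>N\<in>wt. Const (if L = N then 1 else 0) * Indet N)"
    proof (intro sum.cong refl arg_cong2[of _ _ _ _ "(*)"] arg_cong[of _ _ Const])
      fix N assume N: "N \<in> wt"
      have "map (\<lambda>t. act_poly n g (act_poly n h (monomial_poly t))) N = map monomial_poly N"
        using wt_set[OF N]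
        by (auto simp: forms_def monomial_poly_def intro!: act_poly_inverse[OF g h hg, of _ m])
      then show "(\<Sum>M\<in>wt. ?c h N M * ?c g M L) = (if L = N then 1 else 0)"
        unfolding plucker_coord_compose[OF L N] by (simp only: plucker_coord_monomials[OF L N])
    qed
    also have "\<dots> = (\<Sum>N\<in>wt. if L = N then Indet N else 0)" by (intro sum.cong) auto
    finally show ?thesis using L finite_wt by simp
  qed
  then have "coact h (coact g F) = subst Indet F"
    unfolding subst_subst by (intro C_subst_cong[OF F])
  then show ?thesis by (simp add: subst_Indet_id)
qed

lemma act_act:
  assumes "g \<in> GL n" "h \<in> GL n" "h * g = 1\<^sub>m (Suc n)" "P \<in> X"
  shows "act g (act h P) = P"
  using coact_coact[OF GL_carrier[OF assms(1)] GL_carrier[OF assms(2)] assms(3)] Gr_props(1)[OF assms(4)]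
  by (auto simp: act_Gr_def C_coact)

lemma act_one:
  fixes P :: "'k::field plucker_poly set"
  assumes "P \<in> X"
  shows "act (1\<^sub>m (Suc n)) P = P"
proof -
  let ?I = "1\<^sub>m (Suc n) :: 'k mat"
  have "act_poly n ?I (monomial_poly t) = monomial_poly t" if t: "t \<in> T" for t
  proof -
    have "(\<Sum>j\<le>n. Const (?I $$ (i, j)) * Indet j) = Indet i" if "i \<le> n" for i
    proof -
      have "(\<Sum>j\<le>n. Const (?I $$ (i, j)) * Indet j) = (\<Sum>j\<le>n. if j = i then Indet j else 0)"
        using that by (intro sum.cong) auto
      then show ?thesis using that by simp
    qed
    then have "act_poly n ?I (monomial_poly t) = subst Indet (monomial_poly t)"
      unfolding act_poly_def using t
      by (intro subst_cong_keys) (auto simp: monomial_poly_def xterms_deg_def xterms_def)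
    then show ?thesis by (simp add: subst_Indet_id)
  qed
  then have m: "map (\<lambda>t. act_poly n ?I (monomial_poly t)) N = map monomial_poly N" if "N \<in> wt" for N
    using wt_set[OF that] by auto
  have "act_coord prec n m q ?I L = Indet L" if L: "L \<in> wt" for L
  proof -
    have "act_coord prec n m q ?I L = (\<Sum>N\<in>wt. if L = N then Indet N else 0)"
      unfolding act_coord_def by (intro sum.cong refl) (simp add: m plucker_coord_monomials[OF L])
    then show ?thesis using L finite_wt by simp
  qed
  then have "coact ?I F = F" if "F \<in> C" for F
    using C_subst_cong[OF that, of "act_coord prec n m q ?I" Indet] by (simp add: subst_Indet_id)
  then show ?thesis using Gr_props(1)[OF assms] by (auto simp: act_Gr_def)
qed

text \<open>Inclusion of each translate suffices: for the inverse \<open>h\<close> of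
  \<open>g\<close> it puts \<open>act h P\<close> into \<open>Z\<close>, and
  \<open>P = act g (act h P)\<close>.\<close>

lemma GL_stable_iff:
  assumes "Z \<subseteq> X"
  shows "GL_stable prec n m q Z \<longleftrightarrow> (\<forall>g\<in>GL n. \<forall>P\<in>Z. act g P \<in> Z)"
proof
  assume r: "\<forall>g\<in>GL n. \<forall>P\<in>Z. act g P \<in> Z"
  have "Z \<subseteq> act g ` Z" if g: "g \<in> GL n" for g
  proof
    fix P assume P: "P \<in> Z"
    obtain h where h: "h \<in> GL n" "h * g = 1\<^sub>m (Suc n)" using GL_inverse[OF g] .
    then have "P = act g (act h P)" using act_act[OF g h] P assms by auto
    then show "P \<in> act g ` Z" using r h P by blast
  qed
  then show "GL_stable prec n m q Z" using r by (auto simp: GL_stable_def)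
qed (auto simp: GL_stable_def)

lemma GL_stable_Diff:
  assumes "Z \<subseteq> X" "GL_stable prec n m q Z" "GL_stable prec n m q U" "U \<subseteq> Z"
  shows "GL_stable prec n m q (Z - U)"
proof -
  have U: "U \<subseteq> X" and D: "Z - U \<subseteq> X" using assms by auto
  have "act g P \<in> Z - U" if g: "g \<in> GL n" and P: "P \<in> Z - U" for g P
  proof -
    obtain h where h: "h \<in> GL n" "g * h = 1\<^sub>m (Suc n)" using GL_inverse[OF g] .
    have "act h (act g P) = P" using act_act[OF h(1) g h(2)] P assms(1) by auto
    moreover have "act h (act g P) \<in> U" if "act g P \<in> U"
      using that h(1) assms(3) unfolding GL_stable_iff[OF U] by blast
    moreover have "act g P \<in> Z" using P g assms(2) unfolding GL_stable_iff[OF assms(1)] by blast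
    ultimately show ?thesis using P by auto
  qed
  then show ?thesis unfolding GL_stable_iff[OF D] by blast
qed

section \<open>Closed sets, closures and irreducibility in terms of equations\<close>

lemma closedin_Top: "closedin Top A \<longleftrightarrow> (\<exists>J\<subseteq>C. A = {P \<in> X. J \<subseteq> P})" (is "?l \<longleftrightarrow> ?r")
proof
  assume ?l
  then obtain J where "A \<subseteq> X" "J \<subseteq> C" "X - A = {P \<in> X. \<not> J \<subseteq> P}"
    unfolding closedin_def topspace_Gr_topology openin_Gr_topology by blast
  then have "A = X - {P \<in> X. \<not> J \<subseteq> P}" by (metis double_diff order_refl)
  then have "A = {P \<in> X. J \<subseteq> P}" by auto
  then show ?r using \<open>J \<subseteq> C\<close> by (intro exI[of _ J]) simp
next
  assume ?r
  then obtain J where J: "J \<subseteq> C" "A = {P \<in> X. J \<subseteq> P}" by (elim exE conjE)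
  then have "X - A = {P \<in> X. \<not> J \<subseteq> P}" by auto
  then have "openin Top (X - A)" unfolding openin_Gr_topology using J(1) by (intro exI[of _ J]) simp
  then show ?l unfolding closedin_def topspace_Gr_topology using J(2) by auto
qed

text \<open>A point lies in the closure iff every equation of \<open>U\<close> vanishes there. If
  \<open>F\<close> vanishes on \<open>U\<close>, so does its pullback \<open>coact g F\<close>,
  because \<open>U\<close> is stable; hence the pullback vanishes at \<open>P\<close>, that is,
  \<open>F\<close> vanishes at \<open>act g P\<close>.\<close>

lemma GL_stable_closure:
  assumes "W \<subseteq> X" "GL_stable prec n m q W" "closedin Top W" "U \<subseteq> W" "GL_stable prec n m q U"
  shows "GL_stable prec n m q (Top closure_of U)" "Top closure_of U \<subseteq> W"
proof -
  show sub: "Top closure_of U \<subseteq> W" using assms by (intro closure_of_minimal)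
  have cl: "P \<in> Top closure_of U \<longleftrightarrow> P \<in> X \<and> (\<forall>F\<in>C. (\<forall>Q\<in>U. F \<in> Q) \<longrightarrow> F \<in> P)" for P
  proof
    assume P: "P \<in> Top closure_of U"
    then have "P \<in> X" using sub assms(1) by auto
    moreover have "F \<in> P" if "F \<in> C" "\<forall>Q\<in>U. F \<in> Q" for F
    proof -
      have "closedin Top {P \<in> X. {F} \<subseteq> P}" unfolding closedin_Top using that by blast
      then have "Top closure_of U \<subseteq> {P \<in> X. {F} \<subseteq> P}" using that assms(1,4) by (intro closure_of_minimal) auto
      then show ?thesis using P by auto
    qed
    ultimately show "P \<in> X \<and> (\<forall>F\<in>C. (\<forall>Q\<in>U. F \<in> Q) \<longrightarrow> F \<in> P)" by blast
  next
    assume P: "P \<in> X \<and> (\<forall>F\<in>C. (\<forall>Q\<in>U. F \<in> Q) \<longrightarrow> F \<in> P)"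
    obtain J where J: "J \<subseteq> C" "Top closure_of U = {P \<in> X. J \<subseteq> P}"
      using closedin_closure_of[of Top U] unfolding closedin_Top by blast
    have "U \<subseteq> Top closure_of U"
      using assms(1,4) by (intro closure_of_subset) (auto simp: topspace_Gr_topology)
    then have "\<forall>Q\<in>U. J \<subseteq> Q" using J by auto
    then have "J \<subseteq> P" using P J(1) by blast
    then show "P \<in> Top closure_of U" using J P by auto
  qed
  have clX: "Top closure_of U \<subseteq> X" using sub assms(1) by auto
  have UX: "U \<subseteq> X" using assms by auto
  have "act g P \<in> Top closure_of U" if g: "g \<in> GL n" and P: "P \<in> Top closure_of U" for g P
  proof -
    \<comment> \<open>That \<open>act g P\<close> is a point of the Grassmannian is taken from the
      stability of \<open>W\<close>, which contains the closure.\<close>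
    have PW: "P \<in> W" using P sub by auto
    then have "act g P \<in> X" using assms(1,2) g unfolding GL_stable_iff[OF assms(1)] by blast
    moreover have "F \<in> act g P" if F: "F \<in> C" "\<forall>Q\<in>U. F \<in> Q" for F
    proof -
      have "\<forall>Q\<in>U. coact g F \<in> Q"
      proof
        fix Q assume "Q \<in> U"
        then have "act g Q \<in> U" using assms(5) g unfolding GL_stable_iff[OF UX] by blast
        then have "F \<in> act g Q" using F by blast
        then show "coact g F \<in> Q" by (simp add: act_Gr_def)
      qed
      then have "coact g F \<in> P" using P unfolding cl by (simp add: C_coact)
      then show ?thesis using F by (simp add: act_Gr_def)
    qed
    ultimately show ?thesis unfolding cl by blast
  qed
  then show "GL_stable prec n m q (Top closure_of U)" unfolding GL_stable_iff[OF clX] by blast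
qed

text \<open>A proper closed subset of \<open>Z\<close> lies in the zero set of a single polynomial
  that does not vanish on all of \<open>Z\<close>. So irreducibility says that two basic open sets
  that meet \<open>Z\<close> meet inside \<open>Z\<close>, and only two polynomials have to be
  handled at a time.\<close>

lemma irreducible_iff:
  assumes "Z \<subseteq> X"
  shows "irreducible_space (subtopology Top Z) \<longleftrightarrow> Z \<noteq> {} \<and>
    (\<forall>F\<in>C. \<forall>G\<in>C. (\<exists>P\<in>Z. F \<notin> P) \<longrightarrow> (\<exists>P\<in>Z. G \<notin> P) \<longrightarrow> (\<exists>P\<in>Z. F \<notin> P \<and> G \<notin> P))"
    (is "?l \<longleftrightarrow> ?r")
proof -
  have ts: "topspace (subtopology Top Z) = Z" using assms by (auto simp: topspace_Gr_topology)
  have cl: "closedin (subtopology Top Z) A \<longleftrightarrow> (\<exists>J\<subseteq>C. A = {P \<in> Z. J \<subseteq> P})" for A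
  proof
    assume "closedin (subtopology Top Z) A"
    then obtain J where "J \<subseteq> C" "A = {P \<in> X. J \<subseteq> P} \<inter> Z"
      unfolding closedin_subtopology closedin_Top by blast
    then show "\<exists>J\<subseteq>C. A = {P \<in> Z. J \<subseteq> P}" using assms by (intro exI[of _ J]) auto
  next
    assume "\<exists>J\<subseteq>C. A = {P \<in> Z. J \<subseteq> P}"
    then obtain J where J: "J \<subseteq> C" "A = {P \<in> Z. J \<subseteq> P}" by blast
    then have "closedin Top {P \<in> X. J \<subseteq> P}" "A = {P \<in> X. J \<subseteq> P} \<inter> Z"
      unfolding closedin_Top using assms by auto
    then show "closedin (subtopology Top Z) A" unfolding closedin_subtopology by blast
  qed
  show ?thesis
  proof
    assume l: ?l
    show ?r
    proof (intro conjI ballI impI)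
      show "Z \<noteq> {}" using l unfolding irreducible_space_def ts by blast
      fix F G assume FG: "F \<in> C" "G \<in> C" "\<exists>P\<in>Z. F \<notin> P" "\<exists>P\<in>Z. G \<notin> P"
      show "\<exists>P\<in>Z. F \<notin> P \<and> G \<notin> P"
      proof (rule ccontr)
        assume "\<not> ?thesis"
        then have "Z = {P \<in> Z. {F} \<subseteq> P} \<union> {P \<in> Z. {G} \<subseteq> P}" by auto
        moreover have "closedin (subtopology Top Z) {P \<in> Z. {F} \<subseteq> P}"
          "closedin (subtopology Top Z) {P \<in> Z. {G} \<subseteq> P}" unfolding cl using FG(1,2) by blast+
        ultimately have "{P \<in> Z. {F} \<subseteq> P} = Z \<or> {P \<in> Z. {G} \<subseteq> P} = Z"
          using l unfolding irreducible_space_def ts by blast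
        then show False using FG(3,4) by blast
      qed
    qed
  next
    assume r: ?r
    show ?l unfolding irreducible_space_def ts
    proof (intro conjI allI impI)
      show "Z \<noteq> {}" using r by simp
      fix A B assume AB: "closedin (subtopology Top Z) A" "closedin (subtopology Top Z) B" "Z = A \<union> B"
      obtain I J where IJ: "I \<subseteq> C" "A = {P \<in> Z. I \<subseteq> P}" "J \<subseteq> C" "B = {P \<in> Z. J \<subseteq> P}"
        using AB(1,2) unfolding cl by blast
      show "A = Z \<or> B = Z"
      proof (rule ccontr)
        assume "\<not> (A = Z \<or> B = Z)"
        then obtain F G where FG: "F \<in> I" "\<exists>P\<in>Z. F \<notin> P" "G \<in> J" "\<exists>P\<in>Z. G \<notin> P"
          unfolding IJ by blast
        then obtain P where "P \<in> Z" "F \<notin> P" "G \<notin> P" using r IJ by blast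
        then show False using AB(3) FG IJ by blast
      qed
    qed
  qed
qed

text \<open>Polynomial dependence passes from the matrix entries to the images of terms, to their
  coefficients, to the minors of these and finally to the substituted \<open>F\<close>.\<close>

lemma polyfun_coact:
  assumes "\<And>i j. i \<le> n \<Longrightarrow> j \<le> n \<Longrightarrow> polyfun (\<lambda>t. t) (\<lambda>t. g t $$ (i, j))"
    and F: "F \<in> C"
  shows "polyfun Const (\<lambda>t. coact (g t) F)"
  unfolding subst_def
proof (intro polyfun_sum polyfun_mult polyfun_const polyfun_prod polyfun_power)
  fix t L assume "t \<in> Poly_Mapping.keys F" "L \<in> Poly_Mapping.keys t"
  then have L: "L \<in> wt" using F unfolding C_iff by blast
  have a: "polyfun Const (\<lambda>t. act_poly n (g t) (monomial_poly u))" if "u \<in> T" for u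
    unfolding act_poly_def subst_def using that
    by (intro polyfun_sum polyfun_mult polyfun_const polyfun_prod polyfun_power polyfun_Const assms)
      (auto simp: monomial_poly_def xterms_deg_def xterms_def)
  have "polyfun Const (\<lambda>t. Const (plucker_coord (map (\<lambda>u. act_poly n (g t) (monomial_poly u)) M) L) * Indet M)"
    if M: "M \<in> wt" for M
  proof (intro polyfun_mult polyfun_const polyfun_Const)
    show "polyfun (\<lambda>t. t) (\<lambda>t. plucker_coord (map (\<lambda>u. act_poly n (g t) (monomial_poly u)) M) L)"
      unfolding plucker_coord_def wt_length[OF L]
      by (intro polyfun_det)
        (use M in \<open>auto simp: wt_length intro!: polyfun_lookup a wt_nth\<close>)
  qed
  then show "polyfun Const (\<lambda>t. act_coord prec n m q (g t) L)"
    unfolding act_coord_def by (intro polyfun_sum)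
qed

end

section \<open>Irreducible components\<close>

context grassmannian begin

lemma mem_act: "F \<in> act g P \<longleftrightarrow> F \<in> C \<and> coact g F \<in> P"
  by (simp add: act_Gr_def)

text \<open>Two translates of \<open>P\<close> by \<open>g\<close> and \<open>h\<close> are joined by the line through \<open>g\<close> and \<open>h\<close>: over an
  infinite field a generic point of that line is invertible and avoids the zeros of \<open>F\<close> and \<open>G\<close>.\<close>

lemma generic_translate:
  fixes P :: "'k::field plucker_poly set"
  assumes inf: "infinite (UNIV :: 'k set)" and P: "P \<in> X" and gh: "g \<in> GL n" "h \<in> GL n"
    and F: "F \<in> C" "F \<notin> act g P" and G: "G \<in> C" "G \<notin> act h P"
  shows "\<exists>k\<in>GL n. F \<notin> act k P \<and> G \<notin> act k P"
proof -
  \<comment> \<open>The line through \<open>g\<close> and \<open>h\<close>, with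
    \<open>\<gamma> 0 = g\<close> and \<open>\<gamma> 1 = h\<close>. Each of the three open
    conditions below holds at one of these two parameters.\<close>
  define \<gamma> where "\<gamma> t = mat (Suc n) (Suc n) (\<lambda>(i, j). g $$ (i, j) + t * (h $$ (i, j) - g $$ (i, j)))" for t
  have \<gamma>: "\<gamma> 0 = g" "\<gamma> 1 = h" using gh[THEN GL_carrier] by (auto simp: \<gamma>_def intro!: eq_matI)
  have pf: "polyfun (\<lambda>t. t) (\<lambda>t. g $$ (i, j) + t * (h $$ (i, j) - g $$ (i, j)))" for i j
    by (intro polyfun_add polyfun_mult polyfun_const polyfun_base)
  have act: "polyfun Const (\<lambda>t. coact (\<gamma> t) F)" if "F \<in> C" for F
    using that pf by (intro polyfun_coact) (simp_all add: \<gamma>_def)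
  \<comment> \<open>\<open>Const\<close> moves the determinant into the polynomial ring, so that the
    finiteness lemma applies to it with \<open>V = {0}\<close>.\<close>
  have "polyfun Const (\<lambda>t. Const (det (\<gamma> t)) :: 'k plucker_poly)"
    unfolding \<gamma>_def by (intro polyfun_Const polyfun_det pf)
  then have "finite {t. (Const (det (\<gamma> t)) :: 'k plucker_poly) \<in> {0}}"
    by (rule polyfun_nonmember_cofinite[where ?t0.0 = 0, rotated 2])
      (use GL_det[OF gh(1)] in \<open>auto simp: \<gamma>\<close>)
  moreover have "finite {t. coact (\<gamma> t) F \<in> P}"
    by (rule polyfun_nonmember_cofinite[where ?t0.0 = 0, OF Gr_props(2)[OF P] Gr_scale[OF P] act[OF F(1)]])
      (use F in \<open>simp_all add: mem_act \<gamma>\<close>)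
  moreover have "finite {t. coact (\<gamma> t) G \<in> P}"
    by (rule polyfun_nonmember_cofinite[where ?t0.0 = 1, OF Gr_props(2)[OF P] Gr_scale[OF P] act[OF G(1)]])
      (use G in \<open>simp_all add: mem_act \<gamma>\<close>)
  ultimately have "finite ({t. (Const (det (\<gamma> t)) :: 'k plucker_poly) \<in> {0}} \<union>
      {t. coact (\<gamma> t) F \<in> P} \<union> {t. coact (\<gamma> t) G \<in> P})" (is "finite ?B")
    by simp
  from ex_new_if_finite[OF inf this] obtain t where "t \<notin> ?B" ..
  then have t: "det (\<gamma> t) \<noteq> 0" "coact (\<gamma> t) F \<notin> P" "coact (\<gamma> t) G \<notin> P" by simp_all
  then have "\<gamma> t \<in> GL n" by (intro GL_I) (auto simp: \<gamma>_def)
  then show ?thesis using t(2,3) by (auto simp: mem_act)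
qed

text \<open>Two choices have to be merged. Irreducibility of \<open>Z\<close> replaces the points
  \<open>P\<close> and \<open>Q\<close> by one point \<open>V\<close>;
  \<open>generic_translate\<close> at \<open>V\<close> then replaces \<open>g\<close> and
  \<open>h\<close> by one \<open>k\<close>.\<close>

lemma irreducible_saturation:
  fixes Z :: "'k::field plucker_poly set set"
  assumes inf: "infinite (UNIV :: 'k set)" and Z: "Z \<subseteq> X" "irreducible_space (subtopology Top Z)"
    and Y: "Y = {act g P | g P. g \<in> GL n \<and> P \<in> Z}" "Y \<subseteq> X"
  shows "irreducible_space (subtopology Top Y)"
  unfolding irreducible_iff[OF Y(2)]
proof (intro conjI ballI impI)
  show "Y \<noteq> {}" using Z GL_one unfolding irreducible_iff[OF Z(1)] Y(1) by blast
  fix F G assume FG: "F \<in> C" "G \<in> C" "\<exists>P\<in>Y. F \<notin> P" "\<exists>P\<in>Y. G \<notin> P"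
  obtain g P where g: "g \<in> GL n" "P \<in> Z" "F \<notin> act g P" using FG(3) unfolding Y(1) by blast
  obtain h Q where h: "h \<in> GL n" "Q \<in> Z" "G \<notin> act h Q" using FG(4) unfolding Y(1) by blast
  have "coact g F \<notin> P" "coact h G \<notin> Q" using g h FG by (simp_all add: mem_act)
  then obtain V where V: "V \<in> Z" "coact g F \<notin> V" "coact h G \<notin> V"
    using Z(2) g(2) h(2) unfolding irreducible_iff[OF Z(1)] by (meson C_coact)
  have "V \<in> X" using V Z by auto
  then obtain k where "k \<in> GL n" "F \<notin> act k V" "G \<notin> act k V"
    using generic_translate[OF inf _ g(1) h(1) FG(1) _ FG(2)] V by (auto simp: mem_act)
  then show "\<exists>P\<in>Y. F \<notin> P \<and> G \<notin> P" unfolding Y(1) using V(1) by blast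
qed

text \<open>The union of the translates of \<open>Z\<close> is irreducible, contains
  \<open>Z\<close> and stays inside the stable set \<open>A\<close>, so it equals \<open>Z\<close>
  by maximality. \<open>A\<close> is arbitrary in order to cover intersections, complements and
  closures as well as \<open>W\<close>.\<close>

lemma component_stable:
  fixes Z :: "'k::field plucker_poly set set"
  assumes inf: "infinite (UNIV :: 'k set)" and A: "A \<subseteq> X" "GL_stable prec n m q A"
    and Z: "irreducible_component (subtopology Top A) Z"
  shows "Z \<subseteq> A" "GL_stable prec n m q Z"
proof -
  have ts: "topspace (subtopology Top A) = A" using A(1) by (auto simp: topspace_Gr_topology)
  show ZA: "Z \<subseteq> A" using Z unfolding irreducible_component_def ts by blast
  have sub: "subtopology (subtopology Top A) B = subtopology Top B" if "B \<subseteq> A" for B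
    using that by (simp add: subtopology_subtopology Int_absorb1)
  have irr: "irreducible_space (subtopology Top Z)"
    using Z sub[OF ZA] by (simp add: irreducible_component_def)
  define Y where "Y = {act g P | g P. g \<in> GL n \<and> P \<in> Z}"
  have YA: "Y \<subseteq> A" using A ZA unfolding GL_stable_iff[OF A(1)] Y_def by blast
  have "Z \<subseteq> Y"
  proof
    fix P assume "P \<in> Z"
    then have "P = act (1\<^sub>m (Suc n)) P" using act_one ZA A(1) by auto
    then show "P \<in> Y" unfolding Y_def using GL_one \<open>P \<in> Z\<close> by blast
  qed
  moreover have "irreducible_space (subtopology Top Y)"
    using ZA A(1) YA by (intro irreducible_saturation[OF inf _ irr Y_def]) auto
  ultimately have "Y = Z"
    using Z YA sub[OF YA] unfolding irreducible_component_def ts by auto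
  then show "GL_stable prec n m q Z"
    using ZA A(1) by (subst GL_stable_iff) (auto simp: Y_def)
qed

end

section \<open>The exchange property\<close>

text \<open>Cramer's rule. Expanding along the replaced column \<open>i\<close> uses only the
  cofactors of that column, and these do not see the replacement.\<close>

lemma adj_mat_mult_entry:
  fixes A B :: "'a::comm_ring_1 mat"
  assumes A: "A \<in> carrier_mat d d" and B: "B \<in> carrier_mat d d" and ij: "i < d" "j < d"
  shows "(adj_mat A * B) $$ (i, j) = det (replace_col A (col B j) i)"
proof -
  have R: "replace_col A (col B j) i \<in> carrier_mat d d" using A by (simp add: replace_col_def)
  have D: "mat_delete (replace_col A (col B j) i) k i = mat_delete A k i" for k
    using A by (intro eq_matI) (auto simp: mat_delete_def replace_col_def)
  have R1: "replace_col A (col B j) i $$ (k, i) = B $$ (k, j)" if "k < d" for k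
    using assms that by (simp add: replace_col_def)
  have "(adj_mat A * B) $$ (i, j) = (\<Sum>k<d. cofactor A k i * B $$ (k, j))"
    using assms adj_mat(1)[OF A] by (simp add: scalar_prod_def adj_mat_def atLeast0LessThan)
  also have "\<dots> = (\<Sum>k<d. replace_col A (col B j) i $$ (k, i) * cofactor (replace_col A (col B j) i) k i)"
    by (intro sum.cong) (auto simp: cofactor_def D R1)
  also have "\<dots> = det (replace_col A (col B j) i)"
    by (rule laplace_expansion_column[OF R ij(1), symmetric])
  finally show ?thesis .
qed

text \<open>The matrix of replaced determinants is \<open>adj_mat A * B\<close>. With the factor
  \<open>det A\<close> on both sides the identity \<open>det (adj_mat A) * det A = det A ^ d\<close>
  is enough, and nothing has to be cancelled.\<close>

lemma det_replace_cols:
  fixes A B :: "'a::comm_ring_1 mat"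
  assumes A: "A \<in> carrier_mat d d" and B: "B \<in> carrier_mat d d"
  shows "det A * det (mat d d (\<lambda>(i, j). det (replace_col A (col B j) i))) = det A ^ d * det B"
proof -
  have "mat d d (\<lambda>(i, j). det (replace_col A (col B j) i)) = adj_mat A * B"
    using adj_mat_mult_entry[OF A B] adj_mat(1)[OF A] B by (intro eq_matI) auto
  then have "det (mat d d (\<lambda>(i, j). det (replace_col A (col B j) i))) = det (adj_mat A) * det B"
    using det_mult[OF adj_mat(1)[OF A] B] by simp
  moreover have "det (adj_mat A) * det A = det A ^ d"
    using det_mult[OF adj_mat(1)[OF A] A] by (simp add: adj_mat(3)[OF A])
  ultimately show ?thesis by (metis mult.assoc mult.commute)
qed

context grassmannian begin

text \<open>Exchanging an entry of a wedge can destroy its order and its distinctness. A repeated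
  column makes the minor zero; otherwise sorting the columns costs a sign. \<open>E\<close> is the
  polynomial in the coordinates that records the outcome.\<close>

lemma generic_minor_list:
  assumes A: "set A \<subseteq> T" "length A = q"
  shows "\<exists>E\<in>C. subst generic_minor E = (generic_minor A :: (nat \<times> xterm, 'k::field) mpoly) \<and>
    (E = 0 \<or> (\<exists>L\<in>wt. set L = set A \<and> (E = Indet L \<or> E = - Indet L)))"
proof (cases "distinct A")
  case True
  then obtain L where L: "L \<in> wt" "set L = set A"
    using wt_exists[OF A(1)] A(2) by (auto simp: distinct_card)
  then have "mset A = mset L" using True wt_distinct by (metis set_eq_iff_mset_eq_distinct)
  then obtain p where p: "p permutes {..<length L}" "permute_list p L = A"
    by (rule mset_eq_permutation)
  have p': "p permutes {0..<q}" using p(1) wt_length[OF L(1)] by (simp add: atLeast0LessThan)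
  \<comment> \<open>The transposed generic matrix, so that permuting the entries of \<open>L\<close>
    permutes rows.\<close>
  let ?Y = "mat q q (\<lambda>(i, j). Indet (j, L ! i)) :: (nat \<times> xterm, 'k) mpoly mat"
  have Ai: "A ! i = L ! p i" if "i < q" for i
    using p that wt_length[OF L(1)] by (auto simp: permute_list_nth)
  have "generic_minor A = det (transpose_mat (mat q q (\<lambda>(i, j). ?Y $$ (p i, j))))"
    unfolding generic_minor_def A(2) using Ai permutes_less[OF p']
    by (intro arg_cong[of _ _ det] eq_matI) auto
  also have "\<dots> = det (mat q q (\<lambda>(i, j). ?Y $$ (p i, j)))" by (rule det_transpose[of _ q]) simp
  also have "\<dots> = signof p * det ?Y" by (rule det_permute_rows[OF _ p']) simp
  also have "det ?Y = det (transpose_mat ?Y)" by (rule det_transpose[of _ q, symmetric]) simp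
  also have "transpose_mat ?Y = mat q q (\<lambda>(i, j). Indet (i, L ! j))" by (intro eq_matI) auto
  finally have g: "generic_minor A = signof p * (generic_minor L :: (nat \<times> xterm, 'k) mpoly)"
    using wt_length[OF L(1)] by (simp add: generic_minor_def)
  have C_neg: "- Indet L \<in> C"
    using C_mult[OF C_Const[of "-1"] C_Indet[OF L(1)]] by (simp add: Const_uminus)
  show ?thesis
  proof (cases "sign p = 1")
    case True
    then show ?thesis using g L C_Indet[OF L(1)] by (intro bexI[of _ "Indet L"]) auto
  next
    case False
    then have "sign p = -1" by (simp add: sign_def split: if_splits)
    then show ?thesis using g L C_neg by (intro bexI[of _ "- Indet L"]) (auto simp: subst.hom_uminus)
  qed
next
  case False
  then obtain i j where ij: "i < q" "j < q" "i \<noteq> j" "A ! i = A ! j"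
    using A by (auto simp: distinct_conv_nth)
  have "(generic_minor A :: (nat \<times> xterm, 'k) mpoly) = 0"
    unfolding generic_minor_def using ij A(2)
    by (intro det_identical_columns[of _ q i j]) auto
  then show ?thesis using C_0 by (intro bexI[of _ 0]) auto
qed

text \<open>Cramer's rule: modulo the Pluecker ideal, \<open>\<Delta>\<^sub>L\<^sup>q \<Delta>\<^sub>M\<close> is \<open>\<Delta>\<^sub>L\<close> times the determinant of the
  coordinates obtained from \<open>L\<close> by exchanging one entry for one entry of \<open>M\<close>.\<close>

lemma exchange:
  fixes P :: "'k::field plucker_poly set"
  assumes P: "P \<in> X" and LM: "L \<in> wt" "M \<in> wt" "Indet L \<notin> P" "Indet M \<notin> P"
  shows "\<exists>p. p permutes {0..<q} \<and>
    (\<forall>i<q. \<exists>N\<in>wt. set N = set (L[i := M ! p i]) \<and> Indet N \<notin> P)"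
proof -
  have len: "length L = q" "length M = q" using LM wt_length by auto
  define Q where "Q i j E \<longleftrightarrow> E \<in> C \<and>
      subst generic_minor E = (generic_minor (L[i := M ! j]) :: (nat \<times> xterm, 'k) mpoly) \<and>
      (E = 0 \<or> (\<exists>N\<in>wt. set N = set (L[i := M ! j]) \<and> (E = Indet N \<or> E = - Indet N)))" for i j E
  have "\<exists>E. Q i j E" if "j < q" for i j
    unfolding Q_def Bex_def[symmetric]
    using wt_set[OF LM(1)] wt_nth[OF LM(2) that] set_update_subset_insert[of L i "M ! j"] len
    by (intro generic_minor_list) auto
  then have "\<forall>i j. \<exists>E. j < q \<longrightarrow> Q i j E" by blast
  then obtain E where "\<forall>i j. j < q \<longrightarrow> Q i j (E i j)" unfolding choice_iff by (elim exE)
  then have E: "\<And>i j. j < q \<Longrightarrow> E i j \<in> C"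
    "\<And>i j. j < q \<Longrightarrow> subst generic_minor (E i j) = (generic_minor (L[i := M ! j]) :: (nat \<times> xterm, 'k) mpoly)"
    "\<And>i j. j < q \<Longrightarrow> E i j = 0 \<or> (\<exists>N\<in>wt. set N = set (L[i := M ! j]) \<and> (E i j = Indet N \<or> E i j = - Indet N))"
    unfolding Q_def by blast+
  define D where "D = det (mat q q (\<lambda>(i, j). E i j))"
  have D: "D = (\<Sum>p | p permutes {0..<q}. signof p * (\<Prod>i\<in>{0..<q}. E i (p i)))"
    unfolding D_def by (rule det_mat_leibniz)
  have sign: "(signof p :: 'k plucker_poly) = Const (signof p)" for p :: "nat \<Rightarrow> nat"
    by (simp add: sign_def Const_uminus)
  have prodC: "(\<Prod>i\<in>{0..<q}. E i (p i)) \<in> C" if "p permutes {0..<q}" for p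
    using that by (intro C_prod E) (auto simp: permutes_less)
  have DC: "D \<in> C" unfolding D sign by (intro C_sum C_mult C_Const prodC) auto
  let ?Y = "\<lambda>L. mat q q (\<lambda>(i, j). Indet (i, L ! j)) :: (nat \<times> xterm, 'k) mpoly mat"
  \<comment> \<open>Replacing entry \<open>i\<close> of \<open>L\<close> by \<open>M ! j\<close>
    replaces column \<open>i\<close> of the generic matrix of \<open>L\<close> by column
    \<open>j\<close> of that of \<open>M\<close>, so \<open>det_replace_cols\<close>
    applies.\<close>
  have "subst generic_minor D = det (mat q q (\<lambda>(i, j). det (replace_col (?Y L) (col (?Y M) j) i)))"
    unfolding D_def subst.hom_det[symmetric]
    using len by (intro arg_cong[of _ _ det] eq_matI)
      (auto simp: E generic_minor_def replace_col_def nth_list_update intro!: arg_cong[of _ _ det])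
  then have "subst generic_minor (Indet L * D) = subst generic_minor (Indet L ^ q * Indet M)"
    using det_replace_cols[of "?Y L" q "?Y M"] len
    by (simp add: subst.hom_mult subst.hom_power generic_minor_def)
  moreover have Q: "Indet L ^ q * Indet M \<in> C" "Indet L * D \<in> C"
    using DC LM by (auto intro!: C_mult C_power C_Indet)
  ultimately have "Const (-1) * (Indet L * D) + Indet L ^ q * Indet M \<in> plucker_ideal prec n m q"
    unfolding plucker_ideal_def mem_Collect_eq
    by (intro conjI C_add C_mult[OF C_Const] Q)
      (simp only: subst.hom_add subst_mult[of _ "Const (-1)"] subst_Const, simp add: Const_uminus)
  then have rel: "Const (-1) * (Indet L * D) + Indet L ^ q * Indet M \<in> P" using Gr_props(6)[OF P] by blast
  have pow: "Indet L ^ k \<notin> P" for k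
    using Gr_power[OF P C_Indet[OF LM(1)] LM(3)] .
  \<comment> \<open>If \<open>D\<close> vanished at \<open>P\<close>, so would
    \<open>Indet L ^ q * Indet M\<close>, against primality.\<close>
  have "D \<notin> P"
  proof
    assume "D \<in> P"
    then have "Indet L * D \<in> P" using Gr_props(3)[OF P C_Indet[OF LM(1)]] by simp
    then have "Indet L ^ q * Indet M \<in> P"
      using Gr_props(2)[OF P rel, of "Indet L * D"] by (simp add: Const_uminus)
    then show False using Gr_props(4)[OF P C_power[OF C_Indet[OF LM(1)]] C_Indet[OF LM(2)]] pow LM(4) by blast
  qed
  \<comment> \<open>Some summand of the Leibniz expansion of \<open>D\<close> is outside
    \<open>P\<close>. Its permutation is the one sought, since each of its factors is then outside
    \<open>P\<close> too.\<close>
  have "\<exists>p. p permutes {0..<q} \<and> (\<Prod>i\<in>{0..<q}. E i (p i)) \<notin> P"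
  proof (rule ccontr)
    assume n: "\<not> ?thesis"
    have "Const (signof p) * (\<Prod>i\<in>{0..<q}. E i (p i)) \<in> P" if "p \<in> {p. p permutes {0..<q}}" for p
      using n that by (intro Gr_scale[OF P]) blast
    then have "D \<in> P" unfolding D sign by (rule Gr_sum[OF P])
    then show False using \<open>D \<notin> P\<close> by simp
  qed
  then obtain p where p: "p permutes {0..<q}" "(\<Prod>i\<in>{0..<q}. E i (p i)) \<notin> P" by blast
  have "\<exists>N\<in>wt. set N = set (L[i := M ! p i]) \<and> Indet N \<notin> P" if i: "i < q" for i
  proof -
    have pi: "p i < q" using permutes_less[OF p(1) i] .
    have "(\<Prod>i\<in>{0..<q}. E i (p i)) = (\<Prod>i\<in>{0..<q} - {i}. E i (p i)) * E i (p i)"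
      using i by (subst prod.remove[of _ i]) (auto simp: mult.commute)
    moreover have "(\<Prod>i\<in>{0..<q} - {i}. E i (p i)) \<in> C"
      using p(1) by (intro C_prod E) (auto simp: permutes_less)
    ultimately have nP: "E i (p i) \<notin> P" using p(2) Gr_props(3)[OF P] by metis
    then obtain N where N: "N \<in> wt" "set N = set (L[i := M ! p i])" "E i (p i) = Indet N \<or> E i (p i) = - Indet N"
      using E(3)[OF pi] Gr_0[OF P] by metis
    have "Indet N \<notin> P" using N(3) nP Gr_uminus[OF P, of "Indet N"] by auto
    then show ?thesis using N by blast
  qed
  then show ?thesis using p(1) by blast
qed

text \<open>As in a matroid, the lexicographically largest basis is the largest one entry by entry.\<close>

lemma dominance:
  fixes P :: "'k::field plucker_poly set"
  assumes P: "P \<in> X" and L: "L \<in> wt" "Indet L \<notin> P"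
    and max: "\<And>N. N \<in> wt \<Longrightarrow> Indet N \<notin> P \<Longrightarrow> N \<noteq> L \<Longrightarrow> wedge_less prec N L"
    and M: "M \<in> wt" "Indet M \<notin> P"
  shows "\<exists>p. p permutes {0..<q} \<and> (\<forall>i<q. M ! p i = L ! i \<or> prec (M ! p i) (L ! i))"
proof -
  obtain p where p: "p permutes {0..<q}"
    and ex: "\<And>i. i < q \<Longrightarrow> \<exists>N\<in>wt. set N = set (L[i := M ! p i]) \<and> Indet N \<notin> P"
    using exchange[OF P L(1) M(1) L(2) M(2)] by blast
  \<comment> \<open>An entry \<open>t\<close> larger than \<open>L ! i\<close> could be exchanged
    into \<open>L\<close>, and the resulting \<open>N\<close> would contradict the maximality of
    \<open>L\<close>.\<close>
  have "M ! p i = L ! i \<or> prec (M ! p i) (L ! i)" if i: "i < q" for i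
  proof (rule ccontr)
    assume n: "\<not> ?thesis"
    define t where "t = M ! p i"
    have t: "t \<in> T" unfolding t_def using M(1) permutes_less[OF p i] by (rule wt_nth)
    have Lx: "L ! j \<in> xterms n" if "j < q" for j using wt_nth_xterms[OF L(1) that] .
    have tx: "t \<in> xterms n" using t by (rule xterms_degD)
    have "prec (L ! i) t" using n prec_total[OF tx Lx[OF i]] by (auto simp: t_def)
    obtain N where N: "N \<in> wt" "set N = set (L[i := t])" "Indet N \<notin> P" using ex[OF i] by (auto simp: t_def)
    have len: "length L = q" "length N = q" using wt_length L N by auto
    have set_upd: "set (L[i := t]) = insert t (set L - {L ! i})"
      using wt_distinct[OF L(1)] i len by (intro set_update_distinct) auto
    \<comment> \<open>If \<open>t\<close> were already in \<open>L\<close>, the list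
      \<open>N\<close> would have fewer than \<open>q\<close> distinct entries.\<close>
    have "t \<notin> set L"
    proof
      assume "t \<in> set L"
      then have "set N \<subseteq> set L - {L ! i}" using N(2) n set_upd by (auto simp: t_def)
      then have "card (set N) \<le> card (set L - {L ! i})" by (intro card_mono) auto
      also have "\<dots> < card (set L)" using i len by (intro card_Diff1_less) simp_all
      finally show False
        unfolding distinct_card[OF wt_distinct[OF L(1)]] distinct_card[OF wt_distinct[OF N(1)]] len by simp
    qed
    then have "N \<noteq> L" using N(2) set_upd by auto
    then have "wedge_less prec N L" using max N by blast
    then obtain j where j: "j < q" "\<forall>k<j. N ! k = L ! k" "prec (N ! j) (L ! j)"
      using wedge_less_iff[OF N(1) L(1)] by auto
    \<comment> \<open>\<open>s\<close> is the entry at place \<open>j\<close> after the exchange and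
      is at least \<open>L ! j\<close>. It occurs in \<open>N\<close>, but not before place
      \<open>j\<close>, so it is at most \<open>N ! j\<close>, which is below
      \<open>L ! j\<close>.\<close>
    define s where "s = (if j = i then t else L ! j)"
    have Nx: "N ! k \<in> xterms n" if "k < q" for k using wt_nth_xterms[OF N(1) that] .
    have sx: "s \<in> xterms n" using tx Lx[OF j(1)] by (simp add: s_def)
    have "L ! j \<noteq> L ! i" if "j \<noteq> i"
      using that wt_distinct[OF L(1)] i j len by (simp add: nth_eq_iff_index_eq)
    then have "s \<in> set N" using N(2) set_upd j len by (auto simp: s_def)
    then obtain k where k: "k < q" "s = N ! k" using len by (auto simp: in_set_conv_nth)
    have "\<not> k < j"
    proof
      assume "k < j"
      then have "s = L ! k" "k \<noteq> j" using j k by auto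
      then show False using \<open>t \<notin> set L\<close> k(1) j(1) len wt_distinct[OF L(1)]
        by (auto simp: s_def nth_eq_iff_index_eq split: if_splits)
    qed
    then have "s = N ! j \<or> prec s (N ! j)" using wt_prec[OF N(1), of j k] k by (cases "j = k") auto
    then have "prec s (L ! j)" using j prec_trans[OF sx Nx[OF j(1)] Lx[OF j(1)]] by auto
    moreover have "s = L ! j \<or> prec (L ! j) s" using \<open>prec (L ! i) t\<close> by (auto simp: s_def)
    ultimately show False using prec_asym[OF sx Lx[OF j(1)]] prec_irrefl[OF sx] by auto
  qed
  then show ?thesis using p by blast
qed

text \<open>Adding an exponent vector preserves the order, so the summands can be compared one at a
  time; a single strict comparison makes the total strict.\<close>

lemma prec_sum:
  assumes "finite I" "\<And>i. i \<in> I \<Longrightarrow> f i \<in> xterms n" "\<And>i. i \<in> I \<Longrightarrow> g i \<in> xterms n"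
    "\<And>i. i \<in> I \<Longrightarrow> f i = g i \<or> prec (f i) (g i)"
  shows "(\<forall>i\<in>I. f i = g i) \<or> prec (sum f I) (sum g I)"
  using assms
proof (induction I rule: finite_induct)
  case (insert x I)
  have x: "f x \<in> xterms n" "g x \<in> xterms n" "f x = g x \<or> prec (f x) (g x)" using insert.prems by auto
  have s: "sum f I \<in> xterms n" "sum g I \<in> xterms n" using insert.prems by (auto intro: xterms_sum)
  have IH: "(\<forall>i\<in>I. f i = g i) \<or> prec (sum f I) (sum g I)" using insert by auto
  have a: "prec (f x) (g x) \<Longrightarrow> prec (f x + sum f I) (g x + sum f I)" using prec_add x s by blast
  have b: "prec (sum f I) (sum g I) \<Longrightarrow> prec (g x + sum f I) (g x + sum g I)"
    using prec_add[OF s x(2)] by (simp add: add.commute)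
  have c: "sum f I = sum g I" if "\<forall>i\<in>I. f i = g i" using that by (intro sum.cong) auto
  show ?case
  proof (cases "prec (sum f I) (sum g I)")
    case True
    then have "prec (f x + sum f I) (g x + sum g I)"
      using a b[OF True] x prec_trans[of "f x + sum f I" "g x + sum f I" "g x + sum g I"] s xterms_add
      by (metis (no_types))
    then show ?thesis using insert.hyps by simp
  next
    case False
    then have eq: "\<forall>i\<in>I. f i = g i" using IH by simp
    then show ?thesis using x(3) a c[OF eq] insert.hyps by auto
  qed
qed simp

text \<open>\<open>sum_list M\<close> is the product of the terms of \<open>M\<close>, the torus
  weight of the coordinate of \<open>M\<close>. Dominance compares these products factor by factor;
  equality in every place would give \<open>M\<close> the same set of entries as
  \<open>L\<close>.\<close>

lemma dominance_sum_list:
  fixes P :: "'k::field plucker_poly set"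
  assumes P: "P \<in> X" and L: "L \<in> wt" "Indet L \<notin> P"
    and max: "\<And>N. N \<in> wt \<Longrightarrow> Indet N \<notin> P \<Longrightarrow> N \<noteq> L \<Longrightarrow> wedge_less prec N L"
    and M: "M \<in> wt" "Indet M \<notin> P" "M \<noteq> L"
  shows "prec (sum_list M) (sum_list L)"
proof -
  obtain p where p: "p permutes {0..<q}" "\<And>i. i < q \<Longrightarrow> M ! p i = L ! i \<or> prec (M ! p i) (L ! i)"
    using dominance[OF P L max M(1,2)] by blast
  have len: "length L = q" "length M = q" using wt_length L M by auto
  have "sum_list M = (\<Sum>i\<in>{0..<q}. M ! i)" using len by (simp add: sum_list_sum_nth)
  also have "\<dots> = (\<Sum>i\<in>{0..<q}. M ! p i)" by (rule sum.permute[OF p(1), unfolded o_def])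
  finally have sM: "sum_list M = (\<Sum>i\<in>{0..<q}. M ! p i)" .
  have sL: "sum_list L = (\<Sum>i\<in>{0..<q}. L ! i)" using len by (simp add: sum_list_sum_nth)
  have "(\<forall>i\<in>{0..<q}. M ! p i = L ! i) \<or> prec (sum_list M) (sum_list L)"
    unfolding sM sL using p wt_nth_xterms[OF L(1)] wt_nth_xterms[OF M(1)]
    by (intro prec_sum) (auto simp: permutes_less)
  moreover have "\<not> (\<forall>i\<in>{0..<q}. M ! p i = L ! i)"
  proof
    assume "\<forall>i\<in>{0..<q}. M ! p i = L ! i"
    then have "(!) L ` {0..<q} = (!) M ` p ` {0..<q}" unfolding image_image by (intro image_cong) auto
    also have "\<dots> = (!) M ` {0..<q}" by (simp add: permutes_image[OF p(1)])
    finally have "set L = set M" using len by (simp add: nth_image[of q, simplified] nth_image)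
    then show False using wt_unique L M by blast
  qed
  ultimately show ?thesis by blast
qed

end

section \<open>Degeneration along torus orbits\<close>

lemma sum_list_xterms: "set M \<subseteq> xterms n \<Longrightarrow> sum_list M \<in> xterms n"
  by (induction M) (auto intro: xterms_add)

text \<open>Terms are eigenvectors of the diagonal torus, and \<open>meval l t\<close> is the
  character.\<close>

lemma act_poly_diagonal:
  assumes "t \<in> xterms n"
  shows "act_poly n (mat (Suc n) (Suc n) (\<lambda>(i, j). if i = j then l i else 0)) (monomial_poly t) =
    Const (meval l t) * monomial_poly t"
proof -
  have "(\<Sum>j\<le>n. Const (mat (Suc n) (Suc n) (\<lambda>(i, j). if i = j then l i else 0) $$ (i, j)) * Indet j) =
      Const (l i) * Indet i" if "i \<le> n" for i
  proof -
    have "(\<Sum>j\<le>n. Const (mat (Suc n) (Suc n) (\<lambda>(i, j). if i = j then l i else 0) $$ (i, j)) * Indet j) =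
        (\<Sum>j\<le>n. if j = i then Const (l i) * Indet i else 0)"
      using that by (intro sum.cong) auto
    then show ?thesis using that by simp
  qed
  then have "act_poly n (mat (Suc n) (Suc n) (\<lambda>(i, j). if i = j then l i else 0)) (monomial_poly t) =
      meval (\<lambda>i. Const (l i) * Indet i) t"
    unfolding act_poly_monomial meval_def using assms
    by (intro prod.cong refl arg_cong2[of _ _ _ _ "(^)"]) (auto simp: xterms_def)
  also have "\<dots> = Const (meval l t) * monomial_poly t"
    by (simp add: meval_times meval_Indet monomial_poly_def hom_meval[OF Const.comm_ring_hom_axioms])
  finally show ?thesis .
qed

text \<open>The variables are separated one at a time, by induction on the number of those in which the
  exponents already agree with \<open>e0\<close>.\<close>

lemma multigraded_component:
  fixes V :: "('x, 'k::field) mpoly set" and r :: "'u \<Rightarrow> ('x, 'k) mpoly"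
  assumes inf: "infinite (UNIV :: 'k set)"
    and add: "\<And>a b. a \<in> V \<Longrightarrow> b \<in> V \<Longrightarrow> a + b \<in> V"
    and scale: "\<And>c a. a \<in> V \<Longrightarrow> Const c * a \<in> V"
    and A: "finite A" "\<And>u. u \<in> A \<Longrightarrow> e u \<in> xterms n" "e0 \<in> xterms n"
    and torus: "\<And>l. (\<And>i. l i \<noteq> 0) \<Longrightarrow> (\<Sum>u\<in>A. Const (meval l (e u)) * r u) \<in> V"
  shows "(\<Sum>u | u \<in> A \<and> e u = e0. r u) \<in> V"
proof -
  let ?l = "Poly_Mapping.lookup"
  \<comment> \<open>The indices whose exponents agree with \<open>e0\<close> in the first
    \<open>k\<close> variables; these variables no longer occur in the coefficients of the
    sum.\<close>
  let ?A = "\<lambda>k. {u \<in> A. \<forall>i<k. ?l (e u) i = ?l e0 i}"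
  have "\<forall>l. (\<forall>i. l i \<noteq> 0) \<longrightarrow>
      (\<Sum>u\<in>?A k. Const (\<Prod>i\<in>{k..n}. l i ^ ?l (e u) i) * r u) \<in> V" if "k \<le> Suc n" for k
    using that
  proof (induction k)
    case 0
    have "meval l (e u) = (\<Prod>i\<in>{0..n}. l i ^ ?l (e u) i)" if "u \<in> A" for u and l :: "nat \<Rightarrow> 'k"
      using A(2)[OF that] by (intro meval_superset) (auto simp: xterms_def)
    then show ?case using torus by simp
  next
    case (Suc k)
    show ?case
    proof (intro allI impI)
      fix l :: "nat \<Rightarrow> 'k" assume l: "\<forall>i. l i \<noteq> 0"
      define c where "c u = Const (\<Prod>i\<in>{Suc k..n}. l i ^ ?l (e u) i) * r u" for u
      \<comment> \<open>Letting only \<open>l k\<close> vary, as \<open>s\<close>, turns the sum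
        into a polynomial in \<open>s\<close>. Its coefficient at the exponent of \<open>e0\<close>
        keeps exactly the indices in \<open>?A (Suc k)\<close>.\<close>
      define p where "p = (\<Sum>u\<in>?A k. monom (c u) (?l (e u) k))"
      have "poly p (Const s) \<in> V" if "s \<noteq> 0" for s
      proof -
        have "(\<Sum>u\<in>?A k. Const (\<Prod>i\<in>{k..n}. (l(k := s)) i ^ ?l (e u) i) * r u) \<in> V"
          using Suc l that by auto
        moreover have "(\<Prod>i\<in>{k..n}. (l(k := s)) i ^ ?l (e u) i) =
            s ^ ?l (e u) k * (\<Prod>i\<in>{Suc k..n}. l i ^ ?l (e u) i)" for u
          using Suc.prems by (subst prod.atLeast_Suc_atMost) (auto intro!: prod.cong)
        ultimately show ?thesis
          by (simp add: p_def c_def poly_sum poly_monom Const_mult Const_power mult_ac)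
      qed
      then have "UNIV - {0} \<subseteq> {s. poly p (Const s) \<in> V}" by auto
      then have "infinite {s. poly p (Const s) \<in> V}"
        using inf by (meson finite_Diff2 finite.emptyI finite_insert infinite_super)
      then have "coeff p (?l e0 k) \<in> V" using poly_values_in_subspace[of V p, OF add scale] by blast
      moreover have "coeff p (?l e0 k) = (\<Sum>u\<in>?A k. if ?l (e u) k = ?l e0 k then c u else 0)"
        by (simp add: p_def coeff_sum)
      moreover have "\<dots> = (\<Sum>u\<in>?A (Suc k). c u)"
        using A(1) by (intro sum.mono_neutral_cong_right) (auto simp: less_Suc_eq)
      ultimately show "(\<Sum>u\<in>?A (Suc k). Const (\<Prod>i\<in>{Suc k..n}. l i ^ ?l (e u) i) * r u) \<in> V"
        by (simp add: c_def)
    qed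
  qed
  \<comment> \<open>All variables are used up and the remaining products are empty; any
    \<open>l\<close> without zeros may be inserted.\<close>
  from this[of "Suc n"] have "(\<Sum>u\<in>?A (Suc n). r u) \<in> V"
    by (auto dest!: spec[of _ "\<lambda>_. 1"])
  moreover have "?A (Suc n) = {u \<in> A. e u = e0}"
  proof -
    have "?l t i = 0" if "t \<in> xterms n" "\<not> i < Suc n" for t i
      using that by (auto simp: xterms_def in_keys_iff)
    then have "e u = e0" if "u \<in> A" "\<forall>i<Suc n. ?l (e u) i = ?l e0 i" for u
      using that A(2,3) by (intro poly_mapping_eqI) metis
    then show ?thesis by auto
  qed
  ultimately show ?thesis by simp
qed

section \<open>Homogeneous components and coordinate points\<close>

lemma lookup_hom_component:
  "Poly_Mapping.lookup (hom_component d F) t = (if total_deg t = d then Poly_Mapping.lookup F t else 0)"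
proof -
  have "Poly_Mapping.lookup (hom_component d F) t =
      (\<Sum>u\<in>{u \<in> Poly_Mapping.keys F. total_deg u = d}. if u = t then Poly_Mapping.lookup F t else 0)"
    unfolding hom_component_def lookup_sum by (intro sum.cong) (auto simp: lookup_single when_def)
  then show ?thesis by (auto simp: in_keys_iff)
qed

lemma keys_hom_component: "Poly_Mapping.keys (hom_component d F) \<subseteq> Poly_Mapping.keys F"
  by (auto simp: in_keys_iff lookup_hom_component split: if_splits)

lemma total_deg_single [simp]: "total_deg (Poly_Mapping.single x k) = k"
  by (simp add: total_deg_def)

text \<open>Restriction to a coordinate axis: \<open>x\<close> goes to the variable of
  \<open>'k poly\<close> and all other indeterminates go to 0. The kernel is the homogeneous ideal
  of a coordinate point, and its primality can be read off the target.\<close>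

definition axis_poly :: "'x \<Rightarrow> ('x, 'k::comm_ring_1) mpoly \<Rightarrow> 'k poly" where
  "axis_poly x = gsubst (\<lambda>c. [:c:]) (\<lambda>y. if y = x then [:0, 1:] else 0)"

lemma const_poly_hom: "comm_ring_hom (\<lambda>c::'k::comm_ring_1. [:c:])"
  by unfold_locales auto

interpretation axis_poly: comm_ring_hom "axis_poly x" for x
  unfolding axis_poly_def by (rule comm_ring_hom.gsubst_hom[OF const_poly_hom])

lemma coeff_axis_poly:
  fixes F :: "('x, 'k::comm_ring_1) mpoly"
  shows "coeff (axis_poly x F) d = Poly_Mapping.lookup F (Poly_Mapping.single x d)"
proof -
  have "coeff ([:Poly_Mapping.lookup F t:] * meval (\<lambda>y. if y = x then [:0, 1:] else 0) t) d =
      (if t = Poly_Mapping.single x d then Poly_Mapping.lookup F t else 0)" for t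
  proof (cases "Poly_Mapping.keys t \<subseteq> {x}")
    case True
    then have t: "t = Poly_Mapping.single x (Poly_Mapping.lookup t x)"
      by (intro poly_mapping_eqI) (auto simp: lookup_single when_def in_keys_iff)
    obtain k where k: "t = Poly_Mapping.single x k" using t by blast
    have "[:0, 1:] ^ k = (monom 1 k :: 'k poly)" by (simp add: monom_altdef)
    then show ?thesis unfolding k meval_single
      by (auto simp: dest: arg_cong[of _ _ "\<lambda>t. Poly_Mapping.lookup t x"])
  next
    case False
    then obtain y where y: "y \<in> Poly_Mapping.keys t" "y \<noteq> x" by auto
    then have "meval (\<lambda>y. if y = x then [:0, 1:] else 0) t = (0 :: 'k poly)"
      unfolding meval_def by (intro prod_zero) (auto simp: in_keys_iff power_0_left intro!: bexI[of _ y])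
    moreover have "t \<noteq> Poly_Mapping.single x d" using False by (auto split: if_splits)
    ultimately show ?thesis by simp
  qed
  then show ?thesis
    by (simp add: axis_poly_def gsubst_def coeff_sum in_keys_iff)
qed

context grassmannian begin

lemma plucker_ring_ops:
  "F \<otimes>\<^bsub>plucker_ring prec n m q\<^esub> G = F * G" "F \<oplus>\<^bsub>plucker_ring prec n m q\<^esub> G = F + G"
  "\<one>\<^bsub>plucker_ring prec n m q\<^esub> = 1" "\<zero>\<^bsub>plucker_ring prec n m q\<^esub> = 0"
  by (simp_all add: plucker_ring_def)

lemma C_uminus: "F \<in> C \<Longrightarrow> - F \<in> C"
  using C_mult[OF C_Const[of "-1"], of F] by (simp add: Const_uminus)

lemma plucker_ring_cring: "cring (plucker_ring prec n m q :: 'k::field plucker_poly ring)"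
proof (rule cringI)
  show "abelian_group (plucker_ring prec n m q :: 'k plucker_poly ring)"
  proof (rule abelian_groupI, unfold plucker_ring_ops)
    fix F :: "'k plucker_poly" assume "F \<in> C"
    then show "\<exists>G\<in>C. G + F = 0" by (intro bexI[of _ "- F"] C_uminus) simp_all
  qed (simp_all only: C_add C_0 add_ac add_0_left add_0_right)
  show "comm_monoid (plucker_ring prec n m q :: 'k plucker_poly ring)"
    by (rule comm_monoidI, unfold plucker_ring_ops) (simp_all only: C_mult C_1 mult_ac mult_1_left mult_1_right)
qed (simp add: plucker_ring_ops distrib_right)

text \<open>The span of \<open>L\<close> has coordinate 1 at \<open>L\<close> and 0 elsewhere, so
  the component of degree \<open>d\<close> takes as its value there the coefficient of
  \<open>\<Delta>\<^sub>L\<^sup>d\<close>; \<open>axis_poly\<close> collects these for all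
  \<open>d\<close>.\<close>

lemma vs_iff:
  assumes "L \<in> wt"
  shows "F \<in> vs prec n m q L \<longleftrightarrow> F \<in> C \<and> axis_poly L F = (0 :: 'k::field poly)"
proof -
  have "subst (\<lambda>M. Const (plucker_coord (map monomial_poly L) M)) (hom_component d F) =
      (Const (Poly_Mapping.lookup F (Poly_Mapping.single L d)) :: 'k plucker_poly)" if F: "F \<in> C" for d
  proof -
    have "hom_component d F \<in> C" using F keys_hom_component[of d F] unfolding C_iff by blast
    then have "subst (\<lambda>M. Const (plucker_coord (map monomial_poly L) M)) (hom_component d F) =
        (subst (\<lambda>M. Const (if M = L then 1 else 0)) (hom_component d F) :: 'k plucker_poly)"
      by (rule C_subst_cong) (simp add: plucker_coord_monomials[OF _ assms])
    also have "\<dots> = (\<Sum>t\<in>Poly_Mapping.keys (hom_component d F).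
        if t = Poly_Mapping.single L d then Const (Poly_Mapping.lookup F t) else 0)"
      unfolding subst_keys
    proof (intro sum.cong refl)
      fix t assume "t \<in> Poly_Mapping.keys (hom_component d F)"
      then have deg: "total_deg t = d" and lk: "Poly_Mapping.lookup (hom_component d F) t = Poly_Mapping.lookup F t"
        by (auto simp: in_keys_iff lookup_hom_component split: if_splits)
      have "meval (\<lambda>M. Const (if M = L then 1 else 0)) t =
          (if t = Poly_Mapping.single L d then 1 else (0 :: 'k plucker_poly))"
      proof (cases "Poly_Mapping.keys t \<subseteq> {L}")
        case True
        then have "t = Poly_Mapping.single L (Poly_Mapping.lookup t L)"
          by (intro poly_mapping_eqI) (auto simp: lookup_single when_def in_keys_iff)
        then have "t = Poly_Mapping.single L d" using deg by (metis total_deg_single)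
        then show ?thesis by (simp add: meval_single)
      next
        case False
        then obtain M where "M \<in> Poly_Mapping.keys t" "M \<noteq> L" by auto
        then have "meval (\<lambda>M. Const (if M = L then 1 else 0)) t = (0 :: 'k plucker_poly)"
          unfolding meval_def by (intro prod_zero) (auto simp: in_keys_iff power_0_left intro!: bexI[of _ M])
        moreover have "t \<noteq> Poly_Mapping.single L d" using False by (auto split: if_splits)
        ultimately show ?thesis by simp
      qed
      then show "Const (Poly_Mapping.lookup (hom_component d F) t) *
          meval (\<lambda>M. Const (if M = L then 1 else 0)) t =
          (if t = Poly_Mapping.single L d then Const (Poly_Mapping.lookup F t) else (0 :: 'k plucker_poly))"
        by (simp add: lk)
    qed
    also have "\<dots> = Const (Poly_Mapping.lookup F (Poly_Mapping.single L d))"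
      by (auto simp: in_keys_iff lookup_hom_component)
    finally show ?thesis .
  qed
  then show ?thesis
    by (auto simp: vs_def subspace_point_def poly_eq_iff coeff_axis_poly)
qed

text \<open>The set is the kernel of a homomorphism to the domain \<open>'k poly\<close>, hence
  prime. It contains the Pluecker ideal because \<open>axis_poly L\<close> factors through the
  generic minors.\<close>

lemma vs_in_Gr:
  assumes L: "L \<in> wt" and q: "q > 0"
  shows "(vs prec n m q L :: 'k::field plucker_poly set) \<in> X"
proof -
  let ?R = "plucker_ring prec n m q :: 'k plucker_poly ring"
  let ?V = "vs prec n m q L :: 'k plucker_poly set"
  note V = vs_iff[OF L, where ?'k = 'k]
  interpret R: cring ?R by (rule plucker_ring_cring)
  have "ideal ?V ?R"
  proof (rule idealI[OF R.ring_axioms])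
    show "subgroup ?V (add_monoid ?R)"
    proof (rule R.add.subgroupI)
      have "0 \<in> ?V" using C_0 by (simp add: V)
      then show "?V \<noteq> {}" by blast
      fix F assume F: "F \<in> ?V"
      then have FC: "F \<in> C" by (simp add: V)
      have "\<ominus>\<^bsub>?R\<^esub> F = - F"
        by (rule R.minus_equality) (simp_all add: plucker_ring_ops FC C_uminus)
      then show "\<ominus>\<^bsub>?R\<^esub> F \<in> ?V" using F C_uminus[OF FC] by (simp add: V axis_poly.hom_uminus)
    qed (use C_add in \<open>auto simp: V plucker_ring_ops axis_poly.hom_add\<close>)
  qed (use C_mult in \<open>auto simp: V plucker_ring_ops axis_poly.hom_mult\<close>)
  moreover have "C \<noteq> ?V"
  proof -
    have "1 \<notin> ?V" by (simp add: V)
    then show ?thesis using C_1 by blast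
  qed
  ultimately have "primeideal ?V ?R"
    by (intro primeidealI R.cring_axioms) (auto simp: V plucker_ring_ops axis_poly.hom_mult)
  moreover have "hom_component d F \<in> ?V" if "F \<in> ?V" for F d
    using that keys_hom_component[of d F]
    by (auto simp: V C_iff poly_eq_iff coeff_axis_poly lookup_hom_component)
  moreover have "plucker_ideal prec n m q \<subseteq> ?V"
  proof
    fix F :: "'k plucker_poly" assume "F \<in> plucker_ideal prec n m q"
    then have F: "F \<in> C" "subst generic_minor F = 0" by (auto simp: plucker_ideal_def)
    \<comment> \<open>A special matrix: the only nonzero entry of row \<open>i\<close> is in column
      \<open>L ! i\<close>, namely 1, but the variable of \<open>'k poly\<close> in row 0, which
      exists as \<open>q > 0\<close>. Its minor at \<open>L\<close> is that variable and its other
      minors are 0.\<close>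
    define \<rho> where "\<rho> = (\<lambda>(i, t). if t = L ! i then if i = 0 then [:0, 1:] else 1 else (0 :: 'k poly))"
    interpret \<rho>: comm_ring_hom "gsubst (\<lambda>c::'k. [:c:]) \<rho>"
      by (rule comm_ring_hom.gsubst_hom[OF const_poly_hom])
    have "gsubst (\<lambda>c::'k. [:c:]) \<rho> (generic_minor M) = (if M = L then [:0, 1:] else 0)" if M: "M \<in> wt" for M
    proof -
      have "gsubst (\<lambda>c::'k. [:c:]) \<rho> (generic_minor M) =
          det (mat q q (\<lambda>(i, j). if M ! j = L ! i then if i = 0 then [:0, 1:] else 1 else 0))"
        unfolding generic_minor_def \<rho>.hom_det[symmetric] wt_length[OF M]
        by (intro arg_cong[of _ _ det] eq_matI)
          (auto simp: \<rho>_def comm_ring_hom.gsubst_Indet[OF const_poly_hom])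
      also have "\<dots> = (if M = L then (\<Prod>i<q. if i = 0 then [:0, 1:] else 1) else 0)"
        by (rule det_selection[OF M L])
      also have "(\<Prod>i<q. if i = 0 then [:0, 1:] else 1) = ([:0, 1:] :: 'k poly)"
        using q by (simp add: prod.delta)
      finally show ?thesis .
    qed
    moreover have "M \<in> wt" if "t \<in> Poly_Mapping.keys F" "M \<in> Poly_Mapping.keys t" for t M
      using F(1) that unfolding C_iff by blast
    ultimately have "axis_poly L F = gsubst (\<lambda>c. [:c:]) (\<lambda>M. gsubst (\<lambda>c. [:c:]) \<rho> (generic_minor M)) F"
      unfolding axis_poly_def by (intro gsubst_cong_keys) simp
    also have "\<dots> = 0" by (simp add: gsubst_subst[OF const_poly_hom, symmetric] F(2))
    finally show "F \<in> ?V" using F(1) by (simp add: V)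
  qed
  moreover have "Indet L \<notin> ?V"
    by (auto simp: V poly_eq_iff coeff_axis_poly Indet_def lookup_single intro!: exI[of _ 1])
  ultimately show ?thesis using L unfolding Gr_def by blast
qed


text \<open>The torus multidegree of a monomial in the coordinates: the product of all terms of all
  its factors. Powers are written as repeated summands so that \<open>prec_sum\<close>
  applies.\<close>

definition weight :: "(xterm list \<Rightarrow>\<^sub>0 nat) \<Rightarrow> xterm" where
  "weight u = (\<Sum>(M, k)\<in>(SIGMA M:Poly_Mapping.keys u. {..<Poly_Mapping.lookup u M}). sum_list M)"

lemma meval_sum_list: "meval l (sum_list M) = prod_list (map (meval l) M)"
  by (induction M) (simp_all add: meval_add)

lemma meval_weight: "meval l (weight u) = meval (\<lambda>M. meval l (sum_list M)) u"
proof -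
  have "meval l (weight u) =
      (\<Prod>(M, k)\<in>(SIGMA M:Poly_Mapping.keys u. {..<Poly_Mapping.lookup u M}). meval l (sum_list M))"
    unfolding weight_def meval_sum by (intro prod.cong) auto
  then show ?thesis by (simp add: meval_def[of _ u] flip: prod.Sigma)
qed

text \<open>A diagonal matrix multiplies each coordinate, and so each monomial, by the character of
  its weight. This is the shape that \<open>multigraded_component\<close> takes apart.\<close>

lemma coact_diagonal:
  fixes F :: "'k::field plucker_poly"
  assumes F: "F \<in> C"
  shows "coact (mat (Suc n) (Suc n) (\<lambda>(i, j). if i = j then l i else 0)) F =
    (\<Sum>u\<in>Poly_Mapping.keys F. Const (meval l (weight u)) *
      Poly_Mapping.single u (Poly_Mapping.lookup F u))"
proof -
  let ?g = "mat (Suc n) (Suc n) (\<lambda>(i, j). if i = j then l i else 0)"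
  have "act_coord prec n m q ?g L = Const (meval l (sum_list L)) * Indet L" if L: "L \<in> wt" for L
  proof -
    have "plucker_coord (map (\<lambda>t. act_poly n ?g (monomial_poly t)) M) L =
        (if L = M then meval l (sum_list L) else 0)" if M: "M \<in> wt" for M
    proof -
      have eq: "map (\<lambda>t. act_poly n ?g (monomial_poly t)) M = map (\<lambda>t. Const (meval l t) * monomial_poly t) M"
        using wt_set[OF M] by (auto intro!: act_poly_diagonal dest: xterms_degD)
      show ?thesis unfolding eq plucker_coord_scaled_monomials[OF L M]
        using wt_length[OF M] by (simp add: meval_sum_list prod.list_conv_set_nth atLeast0LessThan)
    qed
    then have "act_coord prec n m q ?g L =
        (\<Sum>M\<in>wt. if L = M then Const (meval l (sum_list L)) * Indet M else 0)"
      unfolding act_coord_def by (intro sum.cong) auto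
    then show ?thesis using L finite_wt by simp
  qed
  then have "coact ?g F = subst (\<lambda>L. Const (meval l (sum_list L)) * Indet L) F"
    by (rule C_subst_cong[OF F])
  then show ?thesis
    unfolding subst_keys
    by (simp add: meval_times meval_weight meval_Indet Const_times_single
        flip: hom_meval[OF Const.comm_ring_hom_axioms]) (simp add: mult.commute)
qed

lemma sum_list_wt: "M \<in> wt \<Longrightarrow> sum_list M \<in> xterms n"
  using wt_set[of M] xterms_degD[of _ n m] by (intro sum_list_xterms) blast

lemma weight_xterms: "Poly_Mapping.keys u \<subseteq> wt \<Longrightarrow> weight u \<in> xterms n"
  unfolding weight_def by (intro xterms_sum) (auto intro: sum_list_wt)

lemma total_deg_sum_list_wt: "M \<in> wt \<Longrightarrow> total_deg (sum_list M) = q * m"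
  using wt_set[of M] wt_length[of M]
  by (subst total_deg_sum_list, subst map_cong[OF refl, of M total_deg "\<lambda>_. m"])
    (auto simp: xterms_deg_def sum_list_triv)

text \<open>Each coordinate has a weight of degree \<open>q * m\<close>, so for positive
  \<open>m\<close> and \<open>q\<close> monomials of equal weight have equal degree.\<close>

lemma total_deg_weight:
  assumes "Poly_Mapping.keys u \<subseteq> wt"
  shows "total_deg (weight u) = q * m * total_deg u"
proof -
  have "total_deg (weight u) =
      (\<Sum>(M, k)\<in>(SIGMA M:Poly_Mapping.keys u. {..<Poly_Mapping.lookup u M}). q * m)"
    unfolding weight_def total_deg_sum using assms
    by (intro sum.cong) (auto simp: total_deg_sum_list_wt)
  then show ?thesis by (simp add: total_deg_def sum_distrib_left mult_ac flip: sum.Sigma)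
qed

text \<open>By dominance the monomial \<open>\<Delta>\<^sub>L\<^sup>d\<close> is the only one of its multidegree that does not vanish
  at \<open>P\<close>, so its coefficient in an equation of the torus orbit of \<open>P\<close> is \<open>0\<close>.\<close>

lemma orbit_equation:
  fixes P :: "'k::field plucker_poly set"
  assumes inf: "infinite (UNIV :: 'k set)" and m: "m > 0" and q: "q > 0"
    and P: "P \<in> X" and L: "L \<in> wt" "Indet L \<notin> P"
    and max: "\<And>N. N \<in> wt \<Longrightarrow> Indet N \<notin> P \<Longrightarrow> N \<noteq> L \<Longrightarrow> wedge_less prec N L"
    and F: "F \<in> C" "\<And>g. g \<in> GL n \<Longrightarrow> F \<in> act g P"
  shows "Poly_Mapping.lookup F (Poly_Mapping.single L d) = 0"
proof (rule ccontr)
  define u0 where "u0 = Poly_Mapping.single L d"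
  define c where "c = Poly_Mapping.lookup F"
  assume "Poly_Mapping.lookup F (Poly_Mapping.single L d) \<noteq> 0"
  then have u0: "u0 \<in> Poly_Mapping.keys F" and c0: "c u0 \<noteq> 0"
    by (auto simp: u0_def c_def in_keys_iff)
  have wtF: "Poly_Mapping.keys u \<subseteq> wt" if "u \<in> Poly_Mapping.keys F" for u
    using F(1) that unfolding C_iff by blast
  have monoC: "Poly_Mapping.single u (c u) \<in> C" if "u \<in> Poly_Mapping.keys F" for u
    using wtF[OF that] by (simp add: C_iff)
  let ?U = "{u \<in> Poly_Mapping.keys F. weight u = weight u0}"
  \<comment> \<open>The part of \<open>F\<close> with the weight of \<open>u0\<close> lies in
    \<open>P\<close>, by separating the characters of the torus.\<close>
  have "(\<Sum>u\<in>?U. Poly_Mapping.single u (c u)) \<in> P"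
  proof (rule multigraded_component[OF inf Gr_props(2)[OF P] Gr_scale[OF P]])
    fix l :: "nat \<Rightarrow> 'k" assume l: "\<And>i. l i \<noteq> 0"
    let ?g = "mat (Suc n) (Suc n) (\<lambda>(i, j). if i = j then l i else 0)"
    have "det ?g = prod_list (diag_mat ?g)" by (rule det_upper_triangular[of _ "Suc n"]) auto
    then have "?g \<in> GL n" using l by (intro GL_I) (auto simp: prod_list_diag_prod)
    then have "coact ?g F \<in> P" using F(2) by (auto simp: mem_act)
    then show "(\<Sum>u\<in>Poly_Mapping.keys F. Const (meval l (weight u)) * Poly_Mapping.single u (c u)) \<in> P"
      by (simp add: coact_diagonal[OF F(1)] c_def)
  qed (use wtF u0 in \<open>auto intro!: weight_xterms\<close>)
  moreover have "Poly_Mapping.single u (c u) \<in> P" if u: "u \<in> ?U - {u0}" for u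
  proof -
    have uF: "u \<in> Poly_Mapping.keys F" using u by simp
    have "\<exists>M\<in>Poly_Mapping.keys u. Indet M \<in> P"
    proof (rule ccontr)
      assume n: "\<not> ?thesis"
      let ?I = "SIGMA M:Poly_Mapping.keys u. {..<Poly_Mapping.lookup u M}"
      have d: "total_deg u = d"
        using total_deg_weight[OF wtF[OF uF]] total_deg_weight[OF wtF[OF u0]] u m q by (simp add: u0_def)
      \<comment> \<open>Equal degrees allow both weights to be written as sums over the same index
        set, one index per factor; every factor of \<open>u0\<close> is \<open>L\<close>. For
        \<open>d = 0\<close> both sums are empty.\<close>
      then have "weight u0 = (\<Sum>(M, k)\<in>?I. sum_list L)"
        unfolding weight_def u0_def total_deg_def
        by (cases "d = 0") (simp_all add: flip: sum.Sigma sum_distrib_right)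
      moreover have "weight u = (\<Sum>(M, k)\<in>?I. sum_list M)" by (simp add: weight_def)
      moreover have dom: "sum_list M = sum_list L \<or> prec (sum_list M) (sum_list L)" if "M \<in> Poly_Mapping.keys u" for M
        using dominance_sum_list[OF P L max, of M] that n wtF[OF uF] by blast
      then have "(\<forall>x\<in>?I. (case x of (M, k) \<Rightarrow> sum_list M) = (case x of (M, k) \<Rightarrow> sum_list L)) \<or>
          prec (\<Sum>(M, k)\<in>?I. sum_list M) (\<Sum>(M, k)\<in>?I. sum_list L)"
        using wtF[OF uF] L(1) by (intro prec_sum) (auto intro!: sum_list_wt)
      \<comment> \<open>The weights of \<open>u\<close> and \<open>u0\<close> are equal, which
        excludes a strict comparison.\<close>
      ultimately have eq: "\<forall>x\<in>?I. (case x of (M, k) \<Rightarrow> sum_list M) = sum_list L"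
        using u prec_irrefl[OF weight_xterms[OF wtF[OF u0]]] by auto
      have "M = L" if M: "M \<in> Poly_Mapping.keys u" for M
      proof (rule ccontr)
        assume "M \<noteq> L"
        then have "prec (sum_list M) (sum_list L)"
          using dominance_sum_list[OF P L max, of M] M n wtF[OF uF] by blast
        moreover have "sum_list M = sum_list L"
          using bspec[OF eq, of "(M, 0)"] M by (simp add: in_keys_iff)
        ultimately show False using prec_irrefl[OF sum_list_wt[OF L(1)]] by simp
      qed
      then have "u = Poly_Mapping.single L (Poly_Mapping.lookup u L)"
        by (intro poly_mapping_eqI) (auto simp: lookup_single when_def in_keys_iff)
      then have "u = u0" using d unfolding u0_def by (metis total_deg_single)
      then show False using u by simp
    qed
    then obtain M where M: "M \<in> Poly_Mapping.keys u" "Indet M \<in> P" by blast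
    define u' where "u' = u - Poly_Mapping.single M 1"
    have u': "u = u' + Poly_Mapping.single M 1"
      using M(1) by (intro poly_mapping_eqI)
        (auto simp: u'_def lookup_add lookup_minus lookup_single when_def in_keys_iff)
    have "Poly_Mapping.keys u' \<subseteq> Poly_Mapping.keys u"
      by (auto simp: in_keys_iff u' lookup_add)
    then have "Poly_Mapping.single u' (c u) \<in> C" using wtF[OF uF] by (auto simp: C_iff)
    then have "Poly_Mapping.single u' (c u) * Indet M \<in> P" using M(2) Gr_props(3)[OF P] by blast
    moreover have "Poly_Mapping.single u' (c u) * Indet M = Poly_Mapping.single (u' + Poly_Mapping.single M 1) (c u)"
      by (simp add: Indet_def mult_single)
    ultimately show ?thesis by (simp only: u'[symmetric])
  qed
  then have "(\<Sum>u\<in>?U - {u0}. Poly_Mapping.single u (c u)) \<in> P" by (rule Gr_sum[OF P])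
  moreover have "(\<Sum>u\<in>?U. Poly_Mapping.single u (c u)) =
      Poly_Mapping.single u0 (c u0) + (\<Sum>u\<in>?U - {u0}. Poly_Mapping.single u (c u))"
    using u0 by (intro sum.remove) auto
  ultimately have "Poly_Mapping.single u0 (c u0) \<in> P"
    using Gr_props(2)[OF P, of "\<Sum>u\<in>?U. Poly_Mapping.single u (c u)"
        "- (\<Sum>u\<in>?U - {u0}. Poly_Mapping.single u (c u))"] Gr_uminus[OF P] by simp
  \<comment> \<open>Dividing by the nonzero coefficient would leave a power of
    \<open>Indet L\<close> in the prime \<open>P\<close>.\<close>
  then have "Const (inverse (c u0)) * Poly_Mapping.single u0 (c u0) \<in> P" by (rule Gr_scale[OF P])
  then have "Indet L ^ d \<in> P"
    using c0 by (simp add: Const_times_single u0_def meval_single flip: meval_Indet)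
  then show False using Gr_power[OF P C_Indet[OF L(1)] L(2)] by blast
qed

end

section \<open>The proposition\<close>

context grassmannian begin

lemma DeltaSupp_subset: "DeltaSupp prec n m q A \<subseteq> wt"
  by (auto simp: DeltaSupp_def)

lemma DeltaSupp_nonempty:
  assumes "A \<subseteq> X" "A \<noteq> {}" shows "DeltaSupp prec n m q A \<noteq> {}"
proof -
  obtain P where "P \<in> A" using assms by blast
  then have "P \<in> X" using assms by blast
  then obtain L where "L \<in> wt" "Indet L \<notin> P" unfolding Gr_def by blast
  then show ?thesis using \<open>P \<in> A\<close> \<open>P \<in> X\<close> unfolding DeltaSupp_def U_chart_def by blast
qed

text \<open>Take a point \<open>P\<close> of \<open>A\<close> whose coordinate at the maximum
  \<open>L\<close> does not vanish. Since \<open>W\<close> is stable, its equations hold on the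
  whole orbit of \<open>P\<close>, and \<open>orbit_equation\<close> makes every coefficient vanish
  that is visible at \<open>vs(L)\<close>. \<open>A\<close> will be a subset of \<open>W\<close> or
  the orbit of one.\<close>

lemma vs_in_stable:
  fixes W :: "'k::field plucker_poly set set"
  assumes inf: "infinite (UNIV :: 'k set)" and m: "m > 0" and q: "q > 0"
    and W: "W \<subseteq> X" "closedin Top W" "GL_stable prec n m q W" and A: "A \<subseteq> W" "A \<noteq> {}"
  shows "vs prec n m q (in_ext prec n m q A) \<in> W"
proof -
  define L where "L = in_ext prec n m q A"
  have AX: "A \<subseteq> X" using A(1) W(1) by blast
  note max = wedge_Max_props[OF DeltaSupp_subset DeltaSupp_nonempty[OF AX A(2)], folded in_ext_def, folded L_def]
  obtain P where P: "P \<in> A" "L \<in> wt" "Indet L \<notin> P"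
    using max(1) unfolding DeltaSupp_def U_chart_def by blast
  have PX: "P \<in> X" using P AX by blast
  \<comment> \<open>The support of \<open>P\<close> is part of that of \<open>A\<close>, so
    \<open>L\<close> is the maximum for \<open>P\<close> as well.\<close>
  have mx: "wedge_less prec N L" if "N \<in> wt" "Indet N \<notin> P" "N \<noteq> L" for N
    using that P(1) PX by (intro max(2)) (auto simp: DeltaSupp_def U_chart_def)
  obtain J where J: "J \<subseteq> C" "W = {P \<in> X. J \<subseteq> P}" using W(2) unfolding closedin_Top by blast
  have "F \<in> vs prec n m q L" if "F \<in> J" for F
  proof -
    have F: "F \<in> C" using J(1) that by blast
    have "F \<in> act g P" if "g \<in> GL n" for g
    proof -
      have "act g P \<in> W" using W(3) that P(1) A(1) unfolding GL_stable_iff[OF W(1)] by blast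
      then show ?thesis using J(2) \<open>F \<in> J\<close> by blast
    qed
    then have "Poly_Mapping.lookup F (Poly_Mapping.single L d) = 0" for d
      using orbit_equation[OF inf m q PX P(2,3) mx F] by blast
    then show ?thesis using F by (simp add: vs_iff[OF P(2)] poly_eq_iff coeff_axis_poly)
  qed
  then show ?thesis using vs_in_Gr[OF P(2) q] unfolding J(2) L_def[symmetric] by blast
qed

lemma GL_orbit_stable:
  fixes W :: "'k::field plucker_poly set set"
  assumes "W \<subseteq> X" "GL_stable prec n m q W" "A \<subseteq> W"
  shows "GL_orbit prec n m q A \<subseteq> W" "A \<subseteq> GL_orbit prec n m q A"
proof -
  show "GL_orbit prec n m q A \<subseteq> W"
    using assms unfolding GL_stable_iff[OF assms(1)] GL_orbit_def by blast
  show "A \<subseteq> GL_orbit prec n m q A"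
  proof
    fix P assume P: "P \<in> A"
    then have "act (1\<^sub>m (Suc n)) P = P" using assms by (intro act_one) blast
    then show "P \<in> GL_orbit prec n m q A" unfolding GL_orbit_def using P GL_one by force
  qed
qed

end

theorem proposition3p1:
  fixes prec :: "xterm \<Rightarrow> xterm \<Rightarrow> bool"
    and n m q :: nat
    and W :: "'k::field plucker_poly set set"
  assumes "infinite (UNIV :: 'k set)"
    and "term_order n prec"
    and "\<forall>i j. i < j \<longrightarrow> j \<le> n \<longrightarrow>
           prec (Poly_Mapping.single i 1) (Poly_Mapping.single j 1)"
    and "m > 0" and "q > 0"
    and "W \<noteq> {}"
    and "closedin (Gr_topology prec n m q) W"
    and "GL_stable prec n m q W"
  shows
    "in_ext prec n m q W = gin_ext prec n m q W \<and>

     (\<forall>W'. W' \<noteq> {} \<longrightarrow> W' \<subseteq> W \<longrightarrow>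
        vs prec n m q (in_ext prec n m q W') \<in> W \<and>
        vs prec n m q (gin_ext prec n m q W') \<in> W) \<and>

     (\<not> irreducible_space (subtopology (Gr_topology prec n m q) W) \<longrightarrow>
        (\<forall>Z. irreducible_component (subtopology (Gr_topology prec n m q) W) Z \<longrightarrow>
           GL_stable prec n m q Z)) \<and>

     (\<forall>(l::nat) Y. l \<ge> 1 \<longrightarrow>
        (\<forall>i\<in>{1..l}. irreducible_component (subtopology (Gr_topology prec n m q) W) (Y i)) \<longrightarrow>
        (\<forall>Z. irreducible_component
               (subtopology (Gr_topology prec n m q) (\<Inter>i\<in>{1..l}. Y i)) Z \<longrightarrow>
           GL_stable prec n m q Z)) \<and>

     (\<forall>U. openin (subtopology (Gr_topology prec n m q) W) U \<longrightarrow> GL_stable prec n m q U \<longrightarrow>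
        (\<forall>Z. irreducible_component (subtopology (Gr_topology prec n m q) (W - U)) Z \<longrightarrow>
           GL_stable prec n m q Z) \<and>
        (\<forall>Z. irreducible_component
               (subtopology (Gr_topology prec n m q) (Gr_topology prec n m q closure_of U)) Z \<longrightarrow>
           GL_stable prec n m q Z))"
proof -
  interpret grassmannian prec n m q by unfold_locales fact
  note inf = assms(1) and st = assms(8)
  have W: "W \<subseteq> Gr prec n m q" using closedin_subset[OF assms(7)] by (simp add: topspace_Gr_topology)
  note comp = component_stable[OF inf]
  \<comment> \<open>A stable set is its own orbit, so the two supports coincide.\<close>
  have "GL_orbit prec n m q W = W" using GL_orbit_stable[OF W st subset_refl] by blast
  then have i: "in_ext prec n m q W = gin_ext prec n m q W" by (simp add: in_ext_def gin_ext_def)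
  have ii: "vs prec n m q (in_ext prec n m q W') \<in> W \<and> vs prec n m q (gin_ext prec n m q W') \<in> W"
    if W': "W' \<noteq> {}" "W' \<subseteq> W" for W'
  proof -
    note orb = GL_orbit_stable[OF W st W'(2)]
    have "GL_orbit prec n m q W' \<noteq> {}" using orb W'(1) by blast
    \<comment> \<open>\<open>gin_ext\<close> of \<open>W'\<close> is \<open>in_ext\<close> of its
      orbit, and the orbit is again a nonempty subset of \<open>W\<close>.\<close>
    from vs_in_stable[OF inf assms(4,5) W assms(7) st orb(1) this]
    have "vs prec n m q (gin_ext prec n m q W') \<in> W" by (simp add: in_ext_def gin_ext_def)
    then show ?thesis using vs_in_stable[OF inf assms(4,5) W assms(7) st W'(2,1)] by blast
  qed
  have iv: "GL_stable prec n m q Z"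
    if l: "l \<ge> 1" "\<forall>i\<in>{1..l}. irreducible_component (subtopology (Gr_topology prec n m q) W) (Y i)"
      and Z: "irreducible_component (subtopology (Gr_topology prec n m q) (\<Inter>i\<in>{1..l}. Y i)) Z"
    for l :: nat and Y Z
  proof -
    have Y: "Y i \<subseteq> W" "GL_stable prec n m q (Y i)" if "i \<in> {1..l}" for i
      using comp[OF W st] l(2) that by blast+
    \<comment> \<open>As \<open>l \<ge> 1\<close>, the intersection lies in \<open>Y 1\<close> and
      hence in the Grassmannian.\<close>
    have sub: "(\<Inter>i\<in>{1..l}. Y i) \<subseteq> Gr prec n m q" using Y(1)[of 1] l(1) W by force
    have "act_Gr prec n m q g P \<in> Y i" if "g \<in> GL n" "P \<in> Y i" "i \<in> {1..l}" for g P i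
      using Y(2)[OF that(3)] that(1,2) unfolding GL_stable_def by blast
    then have "GL_stable prec n m q (\<Inter>i\<in>{1..l}. Y i)"
      unfolding GL_stable_iff[OF sub] by blast
    then show ?thesis using comp(2)[OF sub _ Z] by blast
  qed
  have v: "(\<forall>Z. irreducible_component (subtopology (Gr_topology prec n m q) (W - U)) Z \<longrightarrow>
           GL_stable prec n m q Z) \<and>
        (\<forall>Z. irreducible_component
               (subtopology (Gr_topology prec n m q) (Gr_topology prec n m q closure_of U)) Z \<longrightarrow>
           GL_stable prec n m q Z)"
    if U: "openin (subtopology (Gr_topology prec n m q) W) U" "GL_stable prec n m q U" for U
  proof -
    have UW: "U \<subseteq> W" using openin_subset[OF U(1)] by simp
    have "W - U \<subseteq> Gr prec n m q" using W by blast
    moreover have "Gr_topology prec n m q closure_of U \<subseteq> Gr prec n m q"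
      using GL_stable_closure(2)[OF W st assms(7) UW U(2)] W by blast
    ultimately show ?thesis
      using comp(2) GL_stable_Diff[OF W st U(2) UW] GL_stable_closure(1)[OF W st assms(7) UW U(2)]
      by blast
  qed
  show ?thesis using i ii comp(2)[OF W st] iv v by blast
qed

end
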